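(* Let $n\ge2$, let $(\mathbf x^\circ,\mathbf b^\circ)\in\mathcal Z_n$, let $(\mathbf x,\mathbf b)$ be the solution of $(P_n)$ with initial datum $(\mathbf x^\circ,\mathbf b^\circ)$, and let $u_n(t,x)=\frac1n\sum_{i=1}^nb_i(t)H(x-x_i(t))$. Then $u_n$ is a viscosity solution of (HJ$_\varepsilon$) with $\varepsilon=\frac1n$.
   Context: $H$ is the Heaviside function with $H(0)=1$. Particle system. $\mathcal Z_n:=\{(\mathbf x,\mathbf b)\in\mathbb R^n\times\{-1,0,+1\}^n:\ i>j,\ b_ib_j\ne0\Rightarrow x_i>x_j\}$. A solution of $(P_n)$ on $[0,T]$ with initial datum $(\mathbf x^\circ,\mathbf b^\circ)\in\mathcal Z_n$ is a map $(\mathbf x,\mathbf b):[0,T]\to\mathcal Z_n$ for which there is a finite set $S\subset(0,T]$ such that: (a) each $x_i\in C([0,T])\cap C^1([0,T]\setminus S)$ and each $b_i:[0,T]\to\{-1,0,1\}$ is right-continuous; (b) $(\mathbf x(0),\mathbf b(0))=(\mathbf x^\circ,\mathbf b^\circ)$; (c) each $b_i$ jumps at most once; if $b_i$ jumps at $t$ then $t\in S$, $|b_i(t-)|=1$ and $b_i(t)=0$; and for all $(\tau,y)\in S\times\mathbb R$, $\sum_{i:x_i(\tau)=y}(b_i(\tau)-b_i(\tau-))=0$; (d) on $(0,T)\setminus S$, $\frac{dx_i}{dt}=\frac1n\sum_{j\ne i}\frac{b_ib_j}{x_i-x_j}$ (terms with $b_ib_j=0$ are read as $0$). Such solutions exist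 for every $T$ and are unique up to relabeling of particles (which does not affect $u_n$), so $u_n$ is defined on $[0,\infty)\times\mathbb R$. Hamilton--Jacobi equation. $Q=(0,\infty)\times\mathbb R$, $B_\rho=(-\rho,\rho)$. For $\varepsilon>0$ let $E_\varepsilon(\alpha)=\varepsilon(\lfloor\alpha/\varepsilon\rfloor+\frac12)$; its upper and lower semicontinuous envelopes are $E_\varepsilon^*=E_\varepsilon$ and $E_{\varepsilon,*}(\alpha)=\varepsilon\lceil\alpha/\varepsilon\rceil-\frac\varepsilon2$. $\mathrm{pv}\int_{B_\rho}$ means $\lim_{r\to0}\int_{B_\rho\setminus B_r}$. (HJ$_\varepsilon$) is formally $u_t=\mathcal M_\varepsilon[u]\,|u_x|$ with $\mathcal M_\varepsilon[w](x)=\int_{\mathbb R}E_\varepsilon[w(x+z)-w(x)]\frac{dz}{z^2}$. For $\rho>0$, $u$ bounded, $\phi\in C^2(Q)$ with $\phi_x(t,x)\ne0$, set $$\overline H_{\rho,\varepsilon}[\phi,u](t,x)=|\phi_x(t,x)|\Big(\mathrm{pv}\!\int_{B_\rho}E^*_\varepsilon[\phi(t,x+z)-\phi(t,x)]\tfrac{dz}{z^2}+\int_{\mathbb R\setminus B_\rho}E^*_\varepsilon[u(t,x+z)-u(t,x)]\tfrac{dz}{z^2}\Big),$$ and $\underline H_{\rho,\varepsilon}[\phi,u]$ by the same formula with $E_{\varepsilon,*}$ in place of $E^*_\varepsilon$. A bounded upper semicontinuous $u:Q\to\mathbb R$ is a subsolution of (HJ$_\varepsilon$) if, whenever $\phi\in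 C^2(Q)$ and $u-\phi$ has a global maximum at $(\bar t,\bar x)\in Q$: if $\phi_x(\bar t,\bar x)\ne0$ then $\phi_t(\bar t,\bar x)\le\overline H_{\rho,\varepsilon}[\phi,u](\bar t,\bar x)$; if $\phi(t,x)=c|x-\bar x|^4+g(t)$ for some $c\in\mathbb R$ and some $g$, then $\phi_t(\bar t,\bar x)\le0$; otherwise no condition. A bounded lower semicontinuous $v:Q\to\mathbb R$ is a supersolution if, whenever $\psi\in C^2(Q)$ and $v-\psi$ has a global minimum at $(\bar t,\bar x)\in Q$: if $\psi_x(\bar t,\bar x)\ne0$ then $\psi_t(\bar t,\bar x)\ge\underline H_{\rho,\varepsilon}[\psi,v](\bar t,\bar x)$; if $\psi(t,x)=c|x-\bar x|^4+g(t)$ then $\psi_t(\bar t,\bar x)\ge0$; otherwise no condition. These notions do not depend on the choice of $\rho>0$. A function $u$ is a viscosity solution of (HJ$_\varepsilon$) if its upper semicontinuous envelope $u^*$ (in $(t,x)$) is a subsolution and its lower semicontinuous envelope $u_*$ is a supersolution. *)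

theory Defs
  imports "HOL-Analysis.Analysis"
begin

section \<open>The particle system\<close>

text \<open>
  The particles are indexed by \<open>{1..n}\<close>; the values of \<open>x t i\<close> and \<open>b t i\<close> for other \<open>i\<close>, or for
  times outside the time interval, are irrelevant. The charges are real numbers in \<open>{-1, 0, 1}\<close>.
\<close>

definition configs :: "nat \<Rightarrow> ((nat \<Rightarrow> real) \<times> (nat \<Rightarrow> real)) set" where
  "configs n = {(x, b). (\<forall>i\<in>{1..n}. b i \<in> {-1, 0, 1}) \<and>
     (\<forall>i\<in>{1..n}. \<forall>j\<in>{1..n}. i > j \<and> b i * b j \<noteq> 0 \<longrightarrow> x i > x j)}"

definition left_limit :: "(real \<Rightarrow> real) \<Rightarrow> real \<Rightarrow> real" where
  "left_limit f t = Lim (at_left t) f"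

text \<open>
  For a right-continuous function, jumping means failing to be left-continuous. If such a function
  takes values in \<open>{-1, 0, 1}\<close> on \<open>[0, T]\<close> and jumps at most once in \<open>(0, T]\<close>, then it is constant
  before its jump, so that all its left limits exist.
\<close>

definition jumps_at :: "(real \<Rightarrow> real) \<Rightarrow> real \<Rightarrow> bool" where
  "jumps_at f t \<longleftrightarrow> \<not> (f \<longlongrightarrow> f t) (at_left t)"

text \<open>
  In the differential equation, terms with \<open>b t i * b t j = 0\<close> vanish, also when the positions
  coincide, because \<open>0 / 0 = 0\<close>.
\<close>

definition solves_P :: "nat \<Rightarrow> real \<Rightarrow> (nat \<Rightarrow> real) \<Rightarrow> (nat \<Rightarrow> real) \<Rightarrow>
    (real \<Rightarrow> nat \<Rightarrow> real) \<Rightarrow> (real \<Rightarrow> nat \<Rightarrow> real) \<Rightarrow> bool" where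
  "solves_P n T x0 b0 x b \<longleftrightarrow>
     (\<forall>t\<in>{0..T}. (x t, b t) \<in> configs n) \<and>
     (\<exists>S. finite S \<and> S \<subseteq> {0<..T} \<and>
        (\<forall>i\<in>{1..n}. continuous_on {0..T} (\<lambda>t. x t i) \<and>
           (\<exists>v. continuous_on ({0..T} - S) v \<and>
              (\<forall>t\<in>{0..T} - S. ((\<lambda>s. x s i) has_real_derivative v t) (at t within {0..T})))) \<and>
        (\<forall>i\<in>{1..n}. \<forall>t\<in>{0..<T}. ((\<lambda>s. b s i) \<longlongrightarrow> b t i) (at_right t)) \<and>
        (\<forall>i\<in>{1..n}. x 0 i = x0 i \<and> b 0 i = b0 i) \<and>
        (\<forall>i\<in>{1..n}. \<forall>s\<in>{0<..T}. \<forall>t\<in>{0<..T}.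
           jumps_at (\<lambda>r. b r i) s \<and> jumps_at (\<lambda>r. b r i) t \<longrightarrow> s = t) \<and>
        (\<forall>i\<in>{1..n}. \<forall>t\<in>{0<..T}. jumps_at (\<lambda>r. b r i) t \<longrightarrow>
           t \<in> S \<and> \<bar>left_limit (\<lambda>r. b r i) t\<bar> = 1 \<and> b t i = 0) \<and>
        (\<forall>\<tau>\<in>S. \<forall>y. (\<Sum>i | i \<in> {1..n} \<and> x \<tau> i = y. b \<tau> i - left_limit (\<lambda>r. b r i) \<tau>) = 0) \<and>
        (\<forall>i\<in>{1..n}. \<forall>t\<in>{0<..<T} - S.
           ((\<lambda>s. x s i) has_real_derivative
              (1 / real n) * (\<Sum>j\<in>{1..n} - {i}. b t i * b t j / (x t i - x t j))) (at t)))"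

definition heaviside :: "real \<Rightarrow> real" where
  "heaviside z = (if z \<ge> 0 then 1 else 0)"

definition u_n :: "nat \<Rightarrow> (real \<Rightarrow> nat \<Rightarrow> real) \<Rightarrow> (real \<Rightarrow> nat \<Rightarrow> real) \<Rightarrow> real \<times> real \<Rightarrow> real" where
  "u_n n x b = (\<lambda>(t, y). (1 / real n) * (\<Sum>i=1..n. b t i * heaviside (y - x t i)))"

section \<open>Semicontinuity\<close>

definition usc_on :: "'a::topological_space set \<Rightarrow> ('a \<Rightarrow> real) \<Rightarrow> bool" where
  "usc_on D u \<longleftrightarrow> (\<forall>p\<in>D. \<forall>a>u p. \<forall>\<^sub>F q in at p within D. u q < a)"

definition lsc_on :: "'a::topological_space set \<Rightarrow> ('a \<Rightarrow> real) \<Rightarrow> bool" where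
  "lsc_on D u \<longleftrightarrow> (\<forall>p\<in>D. \<forall>a<u p. \<forall>\<^sub>F q in at p within D. u q > a)"

text \<open>
  The envelopes of a function on \<open>D\<close>, at points of \<open>D\<close>. The suprema and infima are those of the
  conditionally complete lattice of the reals, so \<open>u\<close> has to be bounded on bounded subsets of \<open>D\<close>.
\<close>

definition usc_env :: "'a::metric_space set \<Rightarrow> ('a \<Rightarrow> real) \<Rightarrow> 'a \<Rightarrow> real" where
  "usc_env D u p = (INF r\<in>{0<..}. SUP q\<in>ball p r \<inter> D. u q)"

definition lsc_env :: "'a::metric_space set \<Rightarrow> ('a \<Rightarrow> real) \<Rightarrow> 'a \<Rightarrow> real" where
  "lsc_env D u p = (SUP r\<in>{0<..}. INF q\<in>ball p r \<inter> D. u q)"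

section \<open>The Hamilton--Jacobi equation\<close>

definition Q :: "(real \<times> real) set" where
  "Q = {0<..} \<times> UNIV"

definition E :: "real \<Rightarrow> real \<Rightarrow> real" where
  "E \<epsilon> \<alpha> = \<epsilon> * (of_int \<lfloor>\<alpha> / \<epsilon>\<rfloor> + 1 / 2)"

definition E_upper :: "real \<Rightarrow> real \<Rightarrow> real" where
  "E_upper \<epsilon> = E \<epsilon>"

definition E_lower :: "real \<Rightarrow> real \<Rightarrow> real" where
  "E_lower \<epsilon> \<alpha> = \<epsilon> * of_int \<lceil>\<alpha> / \<epsilon>\<rceil> - \<epsilon> / 2"

lemma E_mono: "\<epsilon> > 0 \<Longrightarrow> \<alpha> \<le> \<beta> \<Longrightarrow> E \<epsilon> \<alpha> \<le> E \<epsilon> \<beta>"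
  unfolding E_def by (intro mult_left_mono) (auto intro!: floor_mono divide_right_mono)

lemma E_upper_eq_usc_env:
  assumes "\<epsilon> > 0"
  shows "E_upper \<epsilon> = usc_env UNIV (E \<epsilon>)"
proof
  fix \<alpha> :: real
  have bdd: "bdd_above (E \<epsilon> ` ball \<alpha> r)" for r
    by (rule bdd_aboveI2[of _ _ "E \<epsilon> (\<alpha> + r)"]) (auto intro!: E_mono[OF assms] simp: dist_real_def)
  have ge: "E \<epsilon> \<alpha> \<le> (SUP q\<in>ball \<alpha> r. E \<epsilon> q)" if "r > 0" for r
    using that by (intro cSUP_upper bdd) auto
  define r where "r = \<epsilon> * (of_int \<lfloor>\<alpha> / \<epsilon>\<rfloor> + 1) - \<alpha>"
  have "\<alpha> / \<epsilon> < of_int \<lfloor>\<alpha> / \<epsilon>\<rfloor> + 1"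
    by linarith
  then have r: "r > 0"
    using assms by (simp add: r_def field_simps)
  have "E \<epsilon> q \<le> E \<epsilon> \<alpha>" if "q \<in> ball \<alpha> r" for q
  proof -
    have "q < \<epsilon> * (of_int \<lfloor>\<alpha> / \<epsilon>\<rfloor> + 1)"
      using that by (auto simp: r_def dist_real_def)
    then have "q / \<epsilon> < of_int \<lfloor>\<alpha> / \<epsilon>\<rfloor> + 1"
      using assms by (simp add: field_simps)
    then have "\<lfloor>q / \<epsilon>\<rfloor> \<le> \<lfloor>\<alpha> / \<epsilon>\<rfloor>"
      by linarith
    then show ?thesis
      using assms by (simp add: E_def)
  qed
  then have le: "(SUP q\<in>ball \<alpha> r. E \<epsilon> q) \<le> E \<epsilon> \<alpha>"
    using r by (intro cSUP_least) auto
  have "(INF r\<in>{0<..}. SUP q\<in>ball \<alpha> r. E \<epsilon> q) \<le> (SUP q\<in>ball \<alpha> r. E \<epsilon> q)"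
    using r by (intro cINF_lower bdd_belowI2[of _ "E \<epsilon> \<alpha>"] ge) auto
  moreover have "E \<epsilon> \<alpha> \<le> (INF r\<in>{0<..}. SUP q\<in>ball \<alpha> r. E \<epsilon> q)"
    by (intro cINF_greatest ge) auto
  ultimately show "E_upper \<epsilon> \<alpha> = usc_env UNIV (E \<epsilon>) \<alpha>"
    using le by (simp add: E_upper_def usc_env_def)
qed

lemma E_lower_eq_lsc_env:
  assumes "\<epsilon> > 0"
  shows "E_lower \<epsilon> = lsc_env UNIV (E \<epsilon>)"
proof
  fix \<alpha> :: real
  have bdd: "bdd_below (E \<epsilon> ` ball \<alpha> r)" for r
    by (rule bdd_belowI2[of _ "E \<epsilon> (\<alpha> - r)"]) (auto intro!: E_mono[OF assms] simp: dist_real_def)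
  have ge: "(INF q\<in>ball \<alpha> r. E \<epsilon> q) \<le> E_lower \<epsilon> \<alpha>" if "r > 0" for r
  proof -
    have "(\<alpha> - r / 2) / \<epsilon> < \<alpha> / \<epsilon>"
      using assms that by (simp add: divide_strict_right_mono)
    then have "\<lfloor>(\<alpha> - r / 2) / \<epsilon>\<rfloor> + 1 \<le> \<lceil>\<alpha> / \<epsilon>\<rceil>"
      by linarith
    then have "\<epsilon> * (of_int \<lfloor>(\<alpha> - r / 2) / \<epsilon>\<rfloor> + 1) \<le> \<epsilon> * of_int \<lceil>\<alpha> / \<epsilon>\<rceil>"
      using assms by (intro mult_left_mono) linarith+
    then have "E \<epsilon> (\<alpha> - r / 2) \<le> E_lower \<epsilon> \<alpha>"
      by (simp add: E_def E_lower_def algebra_simps)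
    moreover have "(INF q\<in>ball \<alpha> r. E \<epsilon> q) \<le> E \<epsilon> (\<alpha> - r / 2)"
      using that by (intro cINF_lower bdd) (auto simp: dist_real_def)
    ultimately show ?thesis
      by simp
  qed
  define r where "r = \<alpha> - \<epsilon> * (of_int \<lceil>\<alpha> / \<epsilon>\<rceil> - 1)"
  have "of_int \<lceil>\<alpha> / \<epsilon>\<rceil> - 1 < \<alpha> / \<epsilon>"
    by linarith
  then have r: "r > 0"
    using assms by (simp add: r_def field_simps)
  have "E_lower \<epsilon> \<alpha> \<le> E \<epsilon> q" if "q \<in> ball \<alpha> r" for q
  proof -
    have "\<epsilon> * (of_int \<lceil>\<alpha> / \<epsilon>\<rceil> - 1) < q"
      using that by (auto simp: r_def dist_real_def)
    then have "of_int \<lceil>\<alpha> / \<epsilon>\<rceil> - 1 < q / \<epsilon>"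
      using assms by (simp add: field_simps)
    then have "\<lceil>\<alpha> / \<epsilon>\<rceil> \<le> \<lfloor>q / \<epsilon>\<rfloor> + 1"
      by linarith
    then have "\<epsilon> * of_int \<lceil>\<alpha> / \<epsilon>\<rceil> \<le> \<epsilon> * (of_int \<lfloor>q / \<epsilon>\<rfloor> + 1)"
      using assms by (intro mult_left_mono) linarith+
    then show ?thesis
      by (simp add: E_def E_lower_def algebra_simps)
  qed
  then have le: "E_lower \<epsilon> \<alpha> \<le> (INF q\<in>ball \<alpha> r. E \<epsilon> q)"
    using r by (intro cINF_greatest) auto
  have "(INF q\<in>ball \<alpha> r. E \<epsilon> q) \<le> (SUP r\<in>{0<..}. INF q\<in>ball \<alpha> r. E \<epsilon> q)"
    using r by (intro cSUP_upper bdd_aboveI2[of _ _ "E_lower \<epsilon> \<alpha>"] ge) auto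
  moreover have "(SUP r\<in>{0<..}. INF q\<in>ball \<alpha> r. E \<epsilon> q) \<le> E_lower \<epsilon> \<alpha>"
    by (intro cSUP_least ge) auto
  ultimately show "E_lower \<epsilon> \<alpha> = lsc_env UNIV (E \<epsilon>) \<alpha>"
    using le by (simp add: lsc_env_def)
qed

text \<open>
  Twice continuous Frechet differentiability on an open set; test functions are only relevant on
  \<open>Q\<close>.
\<close>

definition C2_on :: "(real \<times> real) set \<Rightarrow> (real \<times> real \<Rightarrow> real) \<Rightarrow> bool" where
  "C2_on D \<phi> \<longleftrightarrow>
     (\<exists>(\<phi>' :: real \<times> real \<Rightarrow> (real \<times> real) \<Rightarrow>\<^sub>L real)
       (\<phi>'' :: real \<times> real \<Rightarrow> (real \<times> real) \<Rightarrow>\<^sub>L (real \<times> real) \<Rightarrow>\<^sub>L real).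
        (\<forall>p\<in>D. (\<phi> has_derivative blinfun_apply (\<phi>' p)) (at p)) \<and>
        (\<forall>p\<in>D. (\<phi>' has_derivative blinfun_apply (\<phi>'' p)) (at p)) \<and>
        continuous_on D \<phi>'')"

definition dt :: "(real \<times> real \<Rightarrow> real) \<Rightarrow> real \<times> real \<Rightarrow> real" where
  "dt \<phi> = (\<lambda>(t, x). deriv (\<lambda>s. \<phi> (s, x)) t)"

definition dx :: "(real \<times> real \<Rightarrow> real) \<Rightarrow> real \<times> real \<Rightarrow> real" where
  "dx \<phi> = (\<lambda>(t, x). deriv (\<lambda>y. \<phi> (t, y)) x)"

definition pv_integral :: "real \<Rightarrow> (real \<Rightarrow> real) \<Rightarrow> real" where
  "pv_integral \<rho> f = Lim (at_right 0) (\<lambda>r. LINT z:ball 0 \<rho> - ball 0 r|lborel. f z)"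

text \<open>
  For \<open>\<phi>\<close> of class \<open>C\<^sup>2\<close> with nonzero \<open>x\<close>-derivative at \<open>(t, x)\<close> the principal value exists:
  near \<open>z = 0\<close> the first integrand equals \<open>\<plusminus> (\<epsilon> / 2) / z\<^sup>2\<close>, with opposite signs on the two sides.
\<close>

definition hamiltonian :: "(real \<Rightarrow> real) \<Rightarrow> real \<Rightarrow> (real \<times> real \<Rightarrow> real) \<Rightarrow>
    (real \<times> real \<Rightarrow> real) \<Rightarrow> real \<times> real \<Rightarrow> real" where
  "hamiltonian e \<rho> \<phi> u = (\<lambda>(t, x). \<bar>dx \<phi> (t, x)\<bar> *
     (pv_integral \<rho> (\<lambda>z. e (\<phi> (t, x + z) - \<phi> (t, x)) / z\<^sup>2) +
      (LINT z:- ball 0 \<rho>|lborel. e (u (t, x + z) - u (t, x)) / z\<^sup>2)))"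

definition H_upper :: "real \<Rightarrow> real \<Rightarrow> (real \<times> real \<Rightarrow> real) \<Rightarrow> (real \<times> real \<Rightarrow> real) \<Rightarrow>
    real \<times> real \<Rightarrow> real" where
  "H_upper \<rho> \<epsilon> = hamiltonian (E_upper \<epsilon>) \<rho>"

definition H_lower :: "real \<Rightarrow> real \<Rightarrow> (real \<times> real \<Rightarrow> real) \<Rightarrow> (real \<times> real \<Rightarrow> real) \<Rightarrow>
    real \<times> real \<Rightarrow> real" where
  "H_lower \<rho> \<epsilon> = hamiltonian (E_lower \<epsilon>) \<rho>"

definition quartic_at :: "real \<Rightarrow> (real \<times> real \<Rightarrow> real) \<Rightarrow> bool" where
  "quartic_at x0 \<phi> \<longleftrightarrow> (\<exists>c g. \<forall>(t, x)\<in>Q. \<phi> (t, x) = c * \<bar>x - x0\<bar> ^ 4 + g t)"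

definition subsolution :: "real \<Rightarrow> real \<Rightarrow> (real \<times> real \<Rightarrow> real) \<Rightarrow> bool" where
  "subsolution \<rho> \<epsilon> u \<longleftrightarrow>
     bounded (u ` Q) \<and> usc_on Q u \<and>
     (\<forall>\<phi>. \<forall>p\<in>Q. C2_on Q \<phi> \<and> (\<forall>q\<in>Q. u q - \<phi> q \<le> u p - \<phi> p) \<longrightarrow>
        (dx \<phi> p \<noteq> 0 \<longrightarrow> dt \<phi> p \<le> H_upper \<rho> \<epsilon> \<phi> u p) \<and>
        (quartic_at (snd p) \<phi> \<longrightarrow> dt \<phi> p \<le> 0))"

definition supersolution :: "real \<Rightarrow> real \<Rightarrow> (real \<times> real \<Rightarrow> real) \<Rightarrow> bool" where
  "supersolution \<rho> \<epsilon> v \<longleftrightarrow>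
     bounded (v ` Q) \<and> lsc_on Q v \<and>
     (\<forall>\<psi>. \<forall>p\<in>Q. C2_on Q \<psi> \<and> (\<forall>q\<in>Q. v q - \<psi> q \<ge> v p - \<psi> p) \<longrightarrow>
        (dx \<psi> p \<noteq> 0 \<longrightarrow> dt \<psi> p \<ge> H_lower \<rho> \<epsilon> \<psi> v p) \<and>
        (quartic_at (snd p) \<psi> \<longrightarrow> dt \<psi> p \<ge> 0))"

definition viscosity_solution :: "real \<Rightarrow> real \<Rightarrow> (real \<times> real \<Rightarrow> real) \<Rightarrow> bool" where
  "viscosity_solution \<rho> \<epsilon> u \<longleftrightarrow>
     subsolution \<rho> \<epsilon> (usc_env Q u) \<and> supersolution \<rho> \<epsilon> (lsc_env Q u)"

end

theory Submission
  imports Defs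
begin

text \<open>
  Just before a time \<open>\<tau>\<close> the charges \<open>\<beta>\<close> are constant, and near \<open>(\<tau>, y)\<close> the values of \<open>n u\<close> are, up to
  a constant, the partial sums of the charges of the particles that meet at \<open>(\<tau>, y)\<close>. Let a test
  function \<open>\<phi>\<close> touch the upper envelope there. If \<open>\<phi>\<^sub>x > 0\<close>, let \<open>i\<close> be the leftmost particle at which the
  partial sum becomes maximal; if \<open>\<phi>\<^sub>x < 0\<close>, the rightmost one at which it ceases to be maximal. Along its
  path \<open>\<phi>\<close> is at least \<open>\<phi>(\<tau>, y)\<close>. By Abel summation the other meeting particles push \<open>i\<close> in the direction
  of \<open>\<beta> i = sgn \<phi>\<^sub>x\<close>, so that \<open>\<phi>\<^sub>t \<le> - \<bar>\<phi>\<^sub>x\<bar> F\<close>, where \<open>F\<close> is the force of the particles that do not meet.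
  The push even blows up, which rules out \<open>\<phi>\<close>, unless the meeting particles have a net charge and \<open>u\<close>
  after the collision still jumps from or to its maximal value; in that case \<open>- \<bar>\<phi>\<^sub>x\<bar> F\<close> is exactly the
  nonlocal term of the equation. This treats regular points and collisions at once and uses neither
  that colliding charges alternate nor the dynamics after \<open>\<tau>\<close>. For quartic test functions it suffices
  that colliding particles are at distance at most \<open>C (\<tau> - t)\<^bsup>1/2\<^esup>\<close> from \<open>y\<close>. Negating all charges turns
  the supersolution property into the subsolution property.
\<close>

subsection \<open>Semicontinuous envelopes and discretized values\<close>

lemma usc_env_bounds:
  fixes u :: "'a::metric_space \<Rightarrow> real"
  assumes bd: "\<And>q. q \<in> D \<Longrightarrow> \<bar>u q\<bar> \<le> B" and p: "p \<in> D"
  shows usc_env_ge: "u p \<le> usc_env D u p"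
    and usc_env_le_SUP: "r > 0 \<Longrightarrow> usc_env D u p \<le> (SUP q\<in>ball p r \<inter> D. u q)"
proof -
  have bdd: "bdd_above (u ` (ball p r \<inter> D))" for r
    using bd by (intro bdd_aboveI2[where M=B]) (auto simp: abs_le_iff)
  have ge: "u p \<le> (SUP q\<in>ball p r \<inter> D. u q)" if "r > 0" for r
    using that p by (intro cSUP_upper bdd) auto
  show "u p \<le> usc_env D u p"
    unfolding usc_env_def using ge by (intro cINF_greatest) auto
  show "usc_env D u p \<le> (SUP q\<in>ball p r \<inter> D. u q)" if "r > 0"
    unfolding usc_env_def using ge that by (intro cINF_lower bdd_belowI2) auto
qed

text \<open>The bound \<open>c\<close> is asked for only near \<open>p\<close>, so that a
  description of \<open>u\<close> valid in a neighbourhood is enough to control the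
  envelope.\<close>

lemma usc_env_le:
  fixes u :: "'a::metric_space \<Rightarrow> real"
  assumes bd: "\<And>q. q \<in> D \<Longrightarrow> \<bar>u q\<bar> \<le> B" and p: "p \<in> D"
    and c: "\<forall>\<^sub>F q in nhds p. q \<in> D \<longrightarrow> u q \<le> c"
  shows "usc_env D u p \<le> c"
proof -
  obtain r where r: "r > 0" "\<And>q. dist q p < r \<Longrightarrow> q \<in> D \<Longrightarrow> u q \<le> c"
    using c unfolding eventually_nhds_metric by blast
  have "usc_env D u p \<le> (SUP q\<in>ball p r \<inter> D. u q)"
    using bd p r(1) by (rule usc_env_le_SUP)
  also have "\<dots> \<le> c"
  proof (rule cSUP_least)
    show "ball p r \<inter> D \<noteq> {}"
      using p centre_in_ball[of p r] r(1) by blast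
  qed (use r in \<open>auto simp: dist_commute\<close>)
  finally show ?thesis .
qed

lemma usc_env_regular:
  fixes u :: "'a::metric_space \<Rightarrow> real"
  assumes bd: "\<And>q. q \<in> D \<Longrightarrow> \<bar>u q\<bar> \<le> B"
  shows bounded_usc_env: "bounded (usc_env D u ` D)"
    and usc_on_usc_env: "usc_on D (usc_env D u)"
proof -
  have "\<bar>usc_env D u p\<bar> \<le> B" if p: "p \<in> D" for p
  proof -
    have "usc_env D u p \<le> B"
      using bd by (intro usc_env_le[OF bd p] always_eventually) (auto simp: abs_le_iff)
    moreover have "u p \<le> usc_env D u p"
      using bd p by (rule usc_env_ge)
    ultimately show ?thesis
      using bd[OF p] by linarith
  qed
  then show "bounded (usc_env D u ` D)"
    by (auto simp: bounded_iff)
  show "usc_on D (usc_env D u)"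
    unfolding usc_on_def
  proof (intro ballI allI impI)
    fix p a assume p: "p \<in> D" and a: "usc_env D u p < a"
    obtain r where r: "r > 0" "(SUP q\<in>ball p r \<inter> D. u q) < a"
      using a unfolding usc_env_def by (subst (asm) cINF_less_iff)
        (auto intro!: bdd_belowI2[where m="u p"] cSUP_upper bdd_aboveI2[where M=B]
          simp: p abs_le_D1[OF bd])
    have "usc_env D u q < a" if q: "q \<in> D" "q \<in> ball p r" for q
    proof -
      have "\<forall>\<^sub>F q' in nhds q. q' \<in> ball p r"
        using q by (intro eventually_nhds_in_open) auto
      then have "\<forall>\<^sub>F q' in nhds q. q' \<in> D \<longrightarrow> u q' \<le> (SUP q\<in>ball p r \<inter> D. u q)"
        by eventually_elim
          (auto intro!: cSUP_upper bdd_aboveI2[where M=B] simp: abs_le_D1[OF bd])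
      with bd q(1) have "usc_env D u q \<le> (SUP q\<in>ball p r \<inter> D. u q)"
        by (rule usc_env_le)
      with r(2) show ?thesis by simp
    qed
    moreover have "\<forall>\<^sub>F q in at p within D. q \<in> D \<and> q \<in> ball p r"
      using r(1) by (auto simp: eventually_at dist_commute)
    ultimately show "\<forall>\<^sub>F q in at p within D. usc_env D u q < a"
      by (auto elim: eventually_mono)
  qed
qed

text \<open>The infimum of a set of reals is by definition the negated supremum of the negated set,
  so the identity is purely formal.\<close>

lemma lsc_env_eq:
  fixes u :: "'a::metric_space \<Rightarrow> real"
  shows "lsc_env D u p = - usc_env D (\<lambda>q. - u q) p"
  unfolding lsc_env_def usc_env_def Inf_real_def Sup_real_def
  by (simp add: Inf_real_def image_image)

lemma E_lower_eq: "E_lower \<epsilon> \<alpha> = - E_upper \<epsilon> (- \<alpha>)"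
  by (simp add: E_lower_def E_upper_def E_def ceiling_def algebra_simps)

lemma E_upper_measurable: "\<epsilon> > 0 \<Longrightarrow> E_upper \<epsilon> \<in> borel_measurable borel"
  unfolding E_upper_def by (intro borel_measurable_mono monoI E_mono)

lemma E_upper_multiple:
  "\<epsilon> > 0 \<Longrightarrow> E_upper \<epsilon> (\<epsilon> * of_int k) = \<epsilon> * (of_int k + 1/2)"
  by (simp add: E_upper_def E_def)

section \<open>Abel summation and one-sided calculus\<close>

text \<open>Induction by removing the index \<open>k\<close> with the largest \<open>p k\<close>.
  The other terms are bounded with \<open>p k\<close> as common denominator, which the removed term
  has as well. The total numerator is nonpositive, so enlarging the denominator from
  \<open>p k\<close> to \<open>R\<close> increases the quotient.\<close>

lemma abel_inverse_sum_le:
  fixes c p :: "'a \<Rightarrow> real"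
  assumes "finite J" and "inj_on p J" and "\<And>j. j \<in> J \<Longrightarrow> 0 < p j \<and> p j \<le> R"
    and "\<And>k. k \<in> J \<Longrightarrow> (\<Sum>j | j \<in> J \<and> p j \<le> p k. c j) \<le> 0"
  shows "(\<Sum>j\<in>J. c j / p j) \<le> (\<Sum>j\<in>J. c j) / R"
  using assms
proof (induction "card J" arbitrary: J R)
  case 0
  then show ?case by simp
next
  case (Suc m)
  then have "J \<noteq> {}" by auto
  then have "Max (p ` J) \<in> p ` J"
    using Suc.prems by (intro Max_in) auto
  then obtain k where k: "k \<in> J" "p k = Max (p ` J)" by auto
  have le: "p j \<le> p k" if "j \<in> J" for j
    using that Suc.prems(1) k(2) by auto
  define J' where "J' = J - {k}"
  have J: "J = insert k J'" "k \<notin> J'" "finite J'"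
    using k(1) Suc.prems(1) by (auto simp: J'_def)
  have lt: "p j < p k" if "j \<in> J'" for j
    using that le[of j] Suc.prems(2) k(1) unfolding inj_on_def J'_def
    by (metis DiffE insertI1 order_le_less)
  have tot: "(\<Sum>j\<in>J. c j) \<le> 0"
    using Suc.prems(4)[OF k(1)] le by (simp add: Collect_conj_eq Int_absorb2 subset_iff)
  have "(\<Sum>j\<in>J'. c j / p j) \<le> (\<Sum>j\<in>J'. c j) / p k"
  proof (rule Suc.hyps(1))
    show "m = card J'" using Suc.hyps(2) J by simp
    show "inj_on p J'" using Suc.prems(2) J by (auto simp: inj_on_def)
    show "0 < p j \<and> p j \<le> p k" if "j \<in> J'" for j
      using that Suc.prems(3)[of j] J le[of j] by auto
    show "(\<Sum>j | j \<in> J' \<and> p j \<le> p i. c j) \<le> 0" if "i \<in> J'" for i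
    proof -
      have "{j. j \<in> J' \<and> p j \<le> p i} = {j. j \<in> J \<and> p j \<le> p i}"
        using lt[OF that] J by auto
      then show ?thesis using Suc.prems(4)[of i] that J by simp
    qed
  qed (use J in auto)
  then have "(\<Sum>j\<in>J. c j / p j) \<le> (\<Sum>j\<in>J. c j) / p k"
    using J by (simp add: add_divide_distrib)
  also have "\<dots> \<le> (\<Sum>j\<in>J. c j) / R"
    using tot Suc.prems(3)[OF k(1)] by (intro divide_left_mono_neg) auto
  finally show ?case .
qed

text \<open>First-order expansion of \<open>\<phi>\<close> along the path \<open>(t, d t)\<close>.
  The path need not be differentiable at \<open>\<tau>\<close>: only its displacement is bounded,
  and only on one side, which allows unbounded speed near a collision.\<close>

lemma touching_path:
  fixes \<phi> :: "real \<times> real \<Rightarrow> real"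
  assumes der: "(\<phi> has_derivative \<phi>') (at (\<tau>, y))" and nz: "\<phi>' (0, 1) \<noteq> 0"
    and lim: "(d \<longlongrightarrow> y) (at_left \<tau>)"
    and ge: "\<forall>\<^sub>F t in at_left \<tau>. \<phi> (\<tau>, y) \<le> \<phi> (t, d t)"
    and slow: "\<forall>\<^sub>F t in at_left \<tau>. L * (\<tau> - t) \<le> sgn (\<phi>' (0, 1)) * (y - d t)"
  shows "\<phi>' (1, 0) \<le> - \<bar>\<phi>' (0, 1)\<bar> * L"
proof -
  let ?a = "\<phi>' (1, 0)" and ?c = "\<phi>' (0, 1)"
  interpret bounded_linear \<phi>' using der by (rule has_derivative_bounded_linear)
  have lin: "\<phi>' (s, z) = s * ?a + z * ?c" for s z
    using add[of "(s, 0)" "(0, z)"] scaleR[of s "(1, 0)"] scaleR[of z "(0, 1)"] by simp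
  have main: "?a \<le> - \<bar>?c\<bar> * L + \<eta> * (1 + \<bar>L\<bar>)" if \<eta>: "0 < \<eta>" "\<eta> < \<bar>?c\<bar>" for \<eta>
  proof -
    have "((\<lambda>t. (t, d t)) \<longlongrightarrow> (\<tau>, y)) (at_left \<tau>)"
      by (intro tendsto_intros lim)
    moreover have "\<forall>\<^sub>F q in nhds (\<tau>, y). norm (\<phi> q - \<phi> (\<tau>, y) - \<phi>' (q - (\<tau>, y))) \<le> \<eta> * norm (q - (\<tau>, y))"
      using der \<eta>(1) unfolding has_derivative_within_alt eventually_nhds_metric dist_norm
      by fastforce
    ultimately have "\<forall>\<^sub>F t in at_left \<tau>. norm (\<phi> (t, d t) - \<phi> (\<tau>, y) - \<phi>' ((t, d t) - (\<tau>, y)))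
        \<le> \<eta> * norm ((t, d t) - (\<tau>, y))"
      by (rule eventually_compose_filterlim[rotated])
    moreover have "\<forall>\<^sub>F t in at_left \<tau>. t < \<tau>"
      by (simp add: eventually_at_filter)
    ultimately have "\<forall>\<^sub>F t in at_left \<tau>. ?a \<le> - \<bar>?c\<bar> * L + \<eta> * (1 + \<bar>L\<bar>)"
      using ge slow
    proof eventually_elim
      case (elim t)
      define h where "h = \<tau> - t"
      define e where "e = sgn ?c * (y - d t)"
      have h: "h > 0" using elim by (simp add: h_def)
      have ce: "(d t - y) * ?c = - \<bar>?c\<bar> * e" and ae: "\<bar>d t - y\<bar> = \<bar>e\<bar>"
        using nz by (auto simp: e_def sgn_if abs_if algebra_simps)
      have "norm ((t, d t) - (\<tau>, y)) \<le> h + \<bar>e\<bar>"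
        using norm_Pair_le[of "t - \<tau>" "d t - y"] h by (simp add: ae h_def)
      with elim(1) \<eta>(1) have "\<bar>\<phi> (t, d t) - \<phi> (\<tau>, y) - \<phi>' (t - \<tau>, d t - y)\<bar> \<le> \<eta> * (h + \<bar>e\<bar>)"
        by simp (meson mult_left_mono order.trans less_imp_le)
      moreover have "\<phi>' (t - \<tau>, d t - y) = - h * ?a - \<bar>?c\<bar> * e"
        using lin[of "t - \<tau>" "d t - y"] ce by (simp add: h_def)
      ultimately have "h * ?a \<le> - \<bar>?c\<bar> * e + \<eta> * (h + \<bar>e\<bar>)"
        using elim(3) by (simp add: abs_le_iff)
      \<comment> \<open>Since \<open>\<eta> < \<bar>?c\<bar>\<close>, the left side is decreasing in
        \<open>e\<close>, so the lower bound \<open>L * h\<close> can be inserted for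
        \<open>e\<close>.\<close>
      also have "\<dots> \<le> h * (- \<bar>?c\<bar> * L + \<eta> * (1 + \<bar>L\<bar>))"
      proof (cases "e \<ge> 0")
        case True
        have "(\<bar>?c\<bar> - \<eta>) * (L * h) \<le> (\<bar>?c\<bar> - \<eta>) * e"
          using elim(4) \<eta> by (intro mult_left_mono) (auto simp: e_def h_def)
        moreover have "\<eta> * (L * h) \<le> \<eta> * (\<bar>L\<bar> * h)"
          using h \<eta> by (intro mult_left_mono mult_right_mono) auto
        ultimately show ?thesis using True by (simp add: algebra_simps)
      next
        case False
        have "(\<bar>?c\<bar> + \<eta>) * (L * h) \<le> (\<bar>?c\<bar> + \<eta>) * e"
          using elim(4) \<eta> by (intro mult_left_mono) (auto simp: e_def h_def)
        moreover have "- \<eta> * (L * h) \<le> \<eta> * (\<bar>L\<bar> * h)"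
          using mult_left_mono[OF mult_right_mono[of "- L" "\<bar>L\<bar>" h], of \<eta>] h \<eta> by simp
        ultimately show ?thesis using False by (simp add: algebra_simps)
      qed
      finally show ?case using h by (simp add: mult_le_cancel_left_pos)
    qed
    then show ?thesis
      using eventually_happens trivial_limit_at_left_real by blast
  qed
  have "((\<lambda>\<eta>. - \<bar>?c\<bar> * L + \<eta> * (1 + \<bar>L\<bar>)) \<longlongrightarrow> - \<bar>?c\<bar> * L + 0 * (1 + \<bar>L\<bar>)) (at_right 0)"
    by (intro tendsto_intros)
  moreover have "\<forall>\<^sub>F \<eta> in at_right 0. ?a \<le> - \<bar>?c\<bar> * L + \<eta> * (1 + \<bar>L\<bar>)"
    unfolding eventually_at_right_field using nz main by (intro exI[of _ "\<bar>?c\<bar>"]) auto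
  ultimately show ?thesis
    using tendsto_lowerbound[of _ _ "at_right (0::real)" ?a] by auto
qed

text \<open>A quadratic error disappears in the difference quotient from the left. The fourth power
  of a displacement of order \<open>(\<tau> - t)\<close> to the power 1/2 is such an error.\<close>

lemma deriv_nonpos_of_past:
  fixes h :: "real \<Rightarrow> real"
  assumes der: "(h has_real_derivative l) (at \<tau>)"
    and ge: "\<forall>\<^sub>F t in at_left \<tau>. h \<tau> - K * (\<tau> - t)\<^sup>2 \<le> h t"
  shows "l \<le> 0"
proof -
  have "((\<lambda>t. (h t - h \<tau>) / (t - \<tau>)) \<longlongrightarrow> l) (at_left \<tau>)"
    using has_field_derivative_at_within[OF der] by (simp add: has_field_derivative_iff)
  moreover have "((\<lambda>t. K * (\<tau> - t)) \<longlongrightarrow> K * (\<tau> - \<tau>)) (at_left \<tau>)"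
    by (intro tendsto_intros)
  moreover have "\<forall>\<^sub>F t in at_left \<tau>. t < \<tau>"
    by (simp add: eventually_at_filter)
  with ge have "\<forall>\<^sub>F t in at_left \<tau>. (h t - h \<tau>) / (t - \<tau>) \<le> K * (\<tau> - t)"
    by eventually_elim (simp add: divide_simps power2_eq_square algebra_simps)
  ultimately show ?thesis
    using tendsto_le[OF trivial_limit_at_left_real] by force
qed

text \<open>Mean value inequality on \<open>{t..\<tau>}\<close>. At \<open>\<tau>\<close> itself
  only continuity is required, so the lemma applies to particles whose velocity blows up
  there.\<close>

lemma past_growth:
  fixes g :: "real \<Rightarrow> real"
  assumes der: "\<forall>\<^sub>F t in at_left \<tau>. (g has_real_derivative g' t) (at t) \<and> L \<le> g' t"
    and cont: "isCont g \<tau>"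
  shows "\<forall>\<^sub>F t in at_left \<tau>. L * (\<tau> - t) \<le> g \<tau> - g t"
proof -
  obtain t0 where t0: "t0 < \<tau>"
    and d: "\<And>t. t0 < t \<Longrightarrow> t < \<tau> \<Longrightarrow> (g has_real_derivative g' t) (at t) \<and> L \<le> g' t"
    using der unfolding eventually_at_left_field by blast
  have "L * (\<tau> - t) \<le> g \<tau> - g t" if t: "t0 < t" "t < \<tau>" for t
  proof -
    have "g t - L * t \<le> g \<tau> - L * \<tau>"
    proof (rule DERIV_nonneg_imp_increasing_open[of t \<tau> "\<lambda>s. g s - L * s"])
      show "\<exists>y. ((\<lambda>s. g s - L * s) has_real_derivative y) (at s) \<and> 0 \<le> y"
        if "t < s" "s < \<tau>" for s
        using d[of s] that t by (intro exI[of _ "g' s - L"]) (auto intro!: derivative_eq_intros)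
      have "isCont g s" if "s \<in> {t..\<tau>}" for s
        using that t d[of s] cont by (cases "s = \<tau>") (auto intro: DERIV_isCont)
      then show "continuous_on {t..\<tau>} (\<lambda>s. g s - L * s)"
        by (intro continuous_intros continuous_at_imp_continuous_on ballI) auto
    qed (use t in auto)
    then show ?thesis by (simp add: algebra_simps)
  qed
  then show ?thesis
    unfolding eventually_at_left_field using t0 by blast
qed

subsection \<open>The particle system just before a given time\<close>

text \<open>
  The charges just before \<open>\<tau>\<close> are the integers \<open>\<beta>\<close>, while \<open>b \<tau>\<close> are the charges from \<open>\<tau>\<close> on. No collision
  needs to take place at \<open>\<tau>\<close>.
\<close>

locale pre_collision =
  fixes n :: nat and x b :: "real \<Rightarrow> nat \<Rightarrow> real" and \<beta> :: "nat \<Rightarrow> int" and \<tau> \<delta> :: real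
  assumes n_pos: "n > 0" and \<delta>: "0 < \<delta>" "\<delta> \<le> \<tau>"
    and charge: "j \<in> {1..n} \<Longrightarrow> \<beta> j \<in> {-1, 0, 1}"
    and before: "t \<in> {\<tau> - \<delta><..<\<tau>} \<Longrightarrow> j \<in> {1..n} \<Longrightarrow> b t j = of_int (\<beta> j)"
    and after: "t \<in> {\<tau>..<\<tau> + \<delta>} \<Longrightarrow> j \<in> {1..n} \<Longrightarrow> b t j = b \<tau> j"
    and ordered: "t \<in> {\<tau> - \<delta><..<\<tau>} \<Longrightarrow> i \<in> {1..n} \<Longrightarrow> j \<in> {1..n} \<Longrightarrow>
      i < j \<Longrightarrow> \<beta> i \<noteq> 0 \<Longrightarrow> \<beta> j \<noteq> 0 \<Longrightarrow> x t i < x t j"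
    and config: "(x \<tau>, b \<tau>) \<in> configs n"
    and cont: "j \<in> {1..n} \<Longrightarrow> isCont (\<lambda>t. x t j) \<tau>"
    and ode: "t \<in> {\<tau> - \<delta><..<\<tau>} \<Longrightarrow> i \<in> {1..n} \<Longrightarrow> ((\<lambda>s. x s i) has_real_derivative
      (1 / real n) * (\<Sum>j\<in>{1..n} - {i}. of_int (\<beta> i) * of_int (\<beta> j) / (x t i - x t j))) (at t)"
    and conserved: "(\<Sum>j | j \<in> {1..n} \<and> x \<tau> j = y. b \<tau> j) = (\<Sum>j | j \<in> {1..n} \<and> x \<tau> j = y. of_int (\<beta> j))"
begin

abbreviation "u \<equiv> u_n n x b"

text \<open>Grouped by position at time \<open>\<tau>\<close>, both sums have the same total charge
  at every point, even where the charges of single particles differ.\<close>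

lemma regroup:
  "(\<Sum>j=1..n. b \<tau> j * g (x \<tau> j)) = (\<Sum>j=1..n. of_int (\<beta> j) * g (x \<tau> j) :: real)"
proof -
  have "(\<Sum>j=1..n. h j * g (x \<tau> j)) = (\<Sum>v\<in>x \<tau> ` {1..n}. (\<Sum>j | j \<in> {1..n} \<and> x \<tau> j = v. h j) * g v)"
    for h :: "nat \<Rightarrow> real"
    by (subst sum.image_gen[where g="x \<tau>"]) (auto simp: sum_distrib_right intro!: sum.cong)
  then show ?thesis
    by (simp only: conserved)
qed

lemma u_at: "u (\<tau>, z) = (1 / real n) * (\<Sum>j=1..n. of_int (\<beta> j) * heaviside (z - x \<tau> j))"
  unfolding u_n_def using regroup[of "\<lambda>v. heaviside (z - v)"] by simp

lemma u_bound: "\<bar>u (\<tau>, z)\<bar> \<le> 1"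
proof -
  have "\<bar>\<Sum>j=1..n. of_int (\<beta> j) * heaviside (z - x \<tau> j)\<bar> \<le> (\<Sum>j=1..n. 1)"
    using charge by (intro order.trans[OF sum_abs] sum_mono) (force simp: heaviside_def)
  then show ?thesis
    using n_pos by (simp add: u_at abs_mult divide_simps)
qed

section \<open>Particles meeting at a point and their partial sums\<close>

text \<open>A single charged particle at \<open>y\<close> counts as colliding, so that regular
  points and collisions are covered alike.\<close>

definition colliding :: "real \<Rightarrow> nat set"
  where "colliding y = {j \<in> {1..n}. x \<tau> j = y \<and> \<beta> j \<noteq> 0}"

text \<open>
  Just before \<open>\<tau>\<close>, between the colliding particles, \<open>n u\<close> equals \<open>left_sum y + psum y k\<close> immediately to the
  left of particle \<open>k\<close>.
\<close>

definition psum :: "real \<Rightarrow> nat \<Rightarrow> int"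
  where "psum y k = (\<Sum>j | j \<in> colliding y \<and> j < k. \<beta> j)"

definition net :: "real \<Rightarrow> int"
  where "net y = (\<Sum>j\<in>colliding y. \<beta> j)"

text \<open>Index \<open>0\<close> gives the value to the left of all colliding particles and index
  \<open>Suc n\<close> the value to the right of them; no further partial sums occur.\<close>

definition top_psum :: "real \<Rightarrow> int"
  where "top_psum y = Max (psum y ` {..Suc n})"

definition left_sum :: "real \<Rightarrow> int"
  where "left_sum y = (\<Sum>j | j \<in> {1..n} \<and> x \<tau> j < y. \<beta> j)"

text \<open>The largest value of \<open>u\<close> near \<open>(\<tau>, y)\<close> at times before
  \<open>\<tau>\<close>. It bounds the upper envelope at \<open>(\<tau>, y)\<close>.\<close>

definition peak :: "real \<Rightarrow> real"
  where "peak y = (1 / real n) * of_int (left_sum y + top_psum y)"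

text \<open>The velocity that the particles away from \<open>y\<close> would give to a unit positive
  charge at \<open>y\<close> at time \<open>\<tau>\<close>.\<close>

definition force :: "real \<Rightarrow> real"
  where "force y = (1 / real n) * (\<Sum>j | j \<in> {1..n} \<and> x \<tau> j \<noteq> y. of_int (\<beta> j) / (y - x \<tau> j))"

lemma colliding: "finite (colliding y)" "j \<in> colliding y \<Longrightarrow> j \<in> {1..n}"
  "j \<in> colliding y \<Longrightarrow> x \<tau> j = y" "j \<in> colliding y \<Longrightarrow> \<beta> j \<noteq> 0"
  by (auto simp: colliding_def)

lemma psum_0 [simp]: "psum y 0 = 0"
  by (simp add: psum_def)

lemma psum_net: "psum y (Suc n) = net y"
  unfolding psum_def net_def by (rule sum.cong) (auto simp: colliding_def)

lemma psum_Suc: "psum y (Suc k) = psum y k + (if k \<in> colliding y then \<beta> k else 0)"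
proof -
  have "{j \<in> colliding y. j < Suc k} =
      (if k \<in> colliding y then insert k {j \<in> colliding y. j < k} else {j \<in> colliding y. j < k})"
    by (auto simp: less_Suc_eq)
  then show ?thesis
    using colliding(1) by (simp add: psum_def)
qed

lemma psum_beyond: "k \<ge> Suc n \<Longrightarrow> psum y k = net y"
  unfolding psum_def net_def by (rule sum.cong) (auto simp: colliding_def)

lemma psum_le_top: "psum y k \<le> top_psum y"
proof (cases "k \<le> Suc n")
  case True
  then show ?thesis by (auto simp: top_psum_def)
next
  case False
  then have "psum y k = psum y (Suc n)" by (simp add: psum_beyond psum_net)
  then show ?thesis by (auto simp: top_psum_def)
qed

lemma top_attained: obtains k where "k \<le> Suc n" "psum y k = top_psum y"
proof -
  have "top_psum y \<in> psum y ` {..Suc n}"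
    unfolding top_psum_def by (rule Max_in) auto
  then show ?thesis using that by auto
qed

lemma top_bounds: "0 \<le> top_psum y" "net y \<le> top_psum y"
  using psum_le_top[of y 0] psum_le_top[of y "Suc n"] by (auto simp: psum_net)

text \<open>At the least index where the partial sum is maximal, the last step was upward, hence
  made by a positive charge.\<close>

lemma leftmost_peak:
  assumes "0 < top_psum y"
  obtains i where "i \<in> colliding y" "\<beta> i = 1" "psum y (Suc i) = top_psum y"
    "\<And>k. k \<le> i \<Longrightarrow> psum y k < top_psum y"
proof -
  obtain k0 where "psum y k0 = top_psum y"
    using top_attained by blast
  define k where "k = (LEAST k. psum y k = top_psum y)"
  have k: "psum y k = top_psum y"
    unfolding k_def using \<open>psum y k0 = top_psum y\<close> by (rule LeastI)
  have less: "psum y l < top_psum y" if "l < k" for l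
    using not_less_Least[of l "\<lambda>k. psum y k = top_psum y"] that psum_le_top[of y l] by (simp add: k_def)
  \<comment> \<open>\<open>psum y k\<close> counts only indices below \<open>k\<close>, so the
    particle that completes the maximal sum is the predecessor of \<open>k\<close>, which exists
    because \<open>psum y 0 = 0\<close> is not maximal.\<close>
  obtain i where i: "k = Suc i"
    using k assms by (cases k) auto
  have "psum y i < psum y (Suc i)"
    using less[of i] k i by simp
  then have "i \<in> colliding y" "\<beta> i > 0"
    by (auto simp: psum_Suc split: if_splits)
  then show ?thesis
    using that[of i] i k less charge[of i] colliding(2)[of i y] by fastforce
qed

text \<open>At the greatest index where the partial sum is maximal, the next step is downward, so
  the particle with this very index has negative charge.\<close>

lemma rightmost_peak:
  assumes "net y < top_psum y"
  obtains i where "i \<in> colliding y" "\<beta> i = -1" "psum y i = top_psum y"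
    "\<And>k. i < k \<Longrightarrow> psum y k < top_psum y"
proof -
  define P where "P k \<longleftrightarrow> psum y k = top_psum y" for k
  obtain k0 where k0: "P k0"
    using top_attained P_def by blast
  \<comment> \<open>Beyond \<open>n\<close> the partial sums equal \<open>net y\<close>, which is
    not maximal; hence a greatest index exists.\<close>
  have bd: "k \<le> Suc n" if "P k" for k
    using that assms psum_beyond[of k y] by (auto simp: P_def not_less_eq_eq intro: ccontr)
  define i where "i = Greatest P"
  have i: "P i"
    unfolding i_def using k0 bd by (rule GreatestI_nat)
  have less: "psum y k < top_psum y" if "i < k" for k
  proof -
    have "\<not> P k"
      using Greatest_le_nat[of P k "Suc n"] bd that by (auto simp: i_def)
    then show ?thesis using psum_le_top[of y k] by (simp add: P_def)
  qed
  have "psum y (Suc i) < psum y i"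
    using less[of "Suc i"] i by (simp add: P_def)
  then have "i \<in> colliding y" "\<beta> i < 0"
    by (auto simp: psum_Suc split: if_splits)
  then show ?thesis
    using that[of i] i less charge[of i] colliding(2)[of i y] by (fastforce simp: P_def)
qed

text \<open>For quartic test functions the sign of the charge is irrelevant. If the maximum is
  \<open>0\<close>, it is attained to the left of the first colliding particle.\<close>

lemma some_peak:
  assumes "colliding y \<noteq> {}"
  obtains i where "i \<in> colliding y" "psum y i = top_psum y \<or> psum y (Suc i) = top_psum y"
proof (cases "top_psum y = 0")
  case True
  define i where "i = Min (colliding y)"
  have "{j. j \<in> colliding y \<and> j < i} = {}"
    using colliding(1) by (auto simp: i_def not_less)
  then have "psum y i = 0"
    by (simp only: psum_def) simp
  moreover have "i \<in> colliding y"
    using assms colliding(1) by (simp add: i_def)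
  ultimately show ?thesis
    using that True by auto
next
  case False
  then show ?thesis
    using leftmost_peak[of y] top_bounds(1)[of y] that by (metis order_le_less)
qed

section \<open>Values of u near a point\<close>

text \<open>By continuity of the paths, particles away from \<open>y\<close> at time
  \<open>\<tau>\<close> stay on their side of nearby points, so their contribution to
  \<open>u\<close> is locally constant before \<open>\<tau>\<close>, and likewise from
  \<open>\<tau>\<close> on.\<close>

lemma separated:
  "\<forall>\<^sub>F q in nhds (\<tau>, y). fst q \<in> {\<tau> - \<delta><..<\<tau> + \<delta>} \<and>
    (\<forall>j\<in>{1..n}. (x \<tau> j < y \<longrightarrow> x (fst q) j < snd q) \<and> (x \<tau> j > y \<longrightarrow> x (fst q) j > snd q))"
proof -
  have f: "(fst \<longlongrightarrow> \<tau>) (nhds (\<tau>, y))" and s: "(snd \<longlongrightarrow> y) (nhds (\<tau>, y))"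
    using tendsto_fst[OF filterlim_ident] tendsto_snd[OF filterlim_ident] by force+
  have j: "\<forall>\<^sub>F q in nhds (\<tau>, y). (x \<tau> j < y \<longrightarrow> x (fst q) j < snd q) \<and> (x \<tau> j > y \<longrightarrow> x (fst q) j > snd q)"
    if "j \<in> {1..n}" for j
  proof -
    have "((\<lambda>q. snd q - x (fst q) j) \<longlongrightarrow> y - x \<tau> j) (nhds (\<tau>, y))"
      by (intro tendsto_intros s isCont_tendsto_compose[OF cont[OF that] f])
    from order_tendstoD[OF this, of 0]
    have "\<forall>\<^sub>F q in nhds (\<tau>, y). (x \<tau> j < y \<longrightarrow> 0 < snd q - x (fst q) j)"
      "\<forall>\<^sub>F q in nhds (\<tau>, y). (x \<tau> j > y \<longrightarrow> snd q - x (fst q) j < 0)"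
      by (cases "x \<tau> j < y"; cases "x \<tau> j > y"; simp)+
    then show ?thesis
      by eventually_elim auto
  qed
  have "\<forall>\<^sub>F q in nhds (\<tau>, y). \<tau> - \<delta> < fst q" "\<forall>\<^sub>F q in nhds (\<tau>, y). fst q < \<tau> + \<delta>"
    using order_tendstoD[OF f] \<delta> by auto
  moreover have "\<forall>\<^sub>F q in nhds (\<tau>, y). \<forall>j\<in>{1..n}.
      (x \<tau> j < y \<longrightarrow> x (fst q) j < snd q) \<and> (x \<tau> j > y \<longrightarrow> x (fst q) j > snd q)"
    using j by (intro eventually_ball_finite) auto
  ultimately show ?thesis
    by eventually_elim auto
qed

text \<open>Charges and positions are left general, so that the formula serves before
  \<open>\<tau>\<close> with \<open>\<beta>\<close> and after \<open>\<tau>\<close> with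
  \<open>b \<tau>\<close>.\<close>

lemma heaviside_sum:
  fixes c :: "nat \<Rightarrow> real"
  assumes "\<And>j. j \<in> {1..n} \<Longrightarrow> (x \<tau> j < y \<longrightarrow> h j < z) \<and> (x \<tau> j > y \<longrightarrow> h j > z)"
  shows "(\<Sum>j=1..n. c j * heaviside (z - h j)) =
    (\<Sum>j | j \<in> {1..n} \<and> x \<tau> j < y. c j) + (\<Sum>j | j \<in> {1..n} \<and> x \<tau> j = y \<and> h j \<le> z. c j)"
proof -
  have "(\<Sum>j=1..n. c j * heaviside (z - h j)) =
      (\<Sum>j=1..n. (if x \<tau> j < y then c j else 0) + (if x \<tau> j = y \<and> h j \<le> z then c j else 0))"
    using assms by (intro sum.cong refl) (fastforce simp: heaviside_def)
  then show ?thesis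
    by (simp only: sum.distrib sum.inter_filter finite_atLeastAtMost)
qed

lemma u_before:
  "\<forall>\<^sub>F q in nhds (\<tau>, y). fst q < \<tau> \<longrightarrow>
    u q = (1 / real n) * of_int (left_sum y + (\<Sum>j | j \<in> colliding y \<and> x (fst q) j \<le> snd q. \<beta> j))"
  using separated
proof eventually_elim
  case (elim q)
  show ?case
  proof
    assume "fst q < \<tau>"
    with elim have t: "fst q \<in> {\<tau> - \<delta><..<\<tau>}" by auto
    have "u q = (1 / real n) * (\<Sum>j=1..n. b (fst q) j * heaviside (snd q - x (fst q) j))"
      by (simp add: u_n_def split: prod.split)
    also have "(\<Sum>j=1..n. b (fst q) j * heaviside (snd q - x (fst q) j)) =
        (\<Sum>j=1..n. of_int (\<beta> j) * heaviside (snd q - x (fst q) j))"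
      using before[OF t] by (intro sum.cong) auto
    also have "\<dots> = (\<Sum>j | j \<in> {1..n} \<and> x \<tau> j < y. of_int (\<beta> j)) +
        (\<Sum>j | j \<in> {1..n} \<and> x \<tau> j = y \<and> x (fst q) j \<le> snd q. of_int (\<beta> j))"
      using elim by (intro heaviside_sum) auto
    also have "(\<Sum>j | j \<in> {1..n} \<and> x \<tau> j = y \<and> x (fst q) j \<le> snd q. of_int (\<beta> j)) =
        (\<Sum>j | j \<in> colliding y \<and> x (fst q) j \<le> snd q. real_of_int (\<beta> j))"
      by (intro sum.mono_neutral_right) (auto simp: colliding_def)
    finally show "u q = (1 / real n) *
        of_int (left_sum y + (\<Sum>j | j \<in> colliding y \<and> x (fst q) j \<le> snd q. \<beta> j))"
      by (simp add: left_sum_def)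
  qed
qed

text \<open>Charged particles are ordered by index before \<open>\<tau>\<close>, so those not to the
  right of \<open>z\<close> are exactly the colliding indices up to the largest such index.\<close>

lemma initial_segment:
  assumes "t \<in> {\<tau> - \<delta><..<\<tau>}"
  shows "\<exists>k. (\<Sum>j | j \<in> colliding y \<and> x t j \<le> z. \<beta> j) = psum y k"
proof (cases "{j. j \<in> colliding y \<and> x t j \<le> z} = {}")
  case True
  then have "(\<Sum>j | j \<in> colliding y \<and> x t j \<le> z. \<beta> j) = psum y 0"
    by (simp only:) simp
  then show ?thesis ..
next
  case False
  let ?A = "{j. j \<in> colliding y \<and> x t j \<le> z}"
  have fin: "finite ?A" using colliding(1) by simp
  define m where "m = Max ?A"
  have m: "m \<in> ?A" using Max_in[OF fin False] by (simp add: m_def)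
  have "{j. j \<in> colliding y \<and> j < Suc m} = ?A"
  proof (intro equalityI subsetI)
    fix j assume j: "j \<in> {j. j \<in> colliding y \<and> j < Suc m}"
    then show "j \<in> ?A"
      using m ordered[OF assms, of j m] colliding(2,4)[of j y] colliding(2,4)[of m y]
      by (cases "j = m") auto
  next
    fix j assume "j \<in> ?A"
    then show "j \<in> {j. j \<in> colliding y \<and> j < Suc m}"
      using Max_ge[OF fin, of j] by (auto simp: m_def)
  qed
  then have "(\<Sum>j\<in>?A. \<beta> j) = psum y (Suc m)" by (simp only: psum_def)
  then show ?thesis ..
qed

lemma net_at: "(\<Sum>j | j \<in> {1..n} \<and> x \<tau> j = y. b \<tau> j) = of_int (net y)"
proof -
  have "(\<Sum>j | j \<in> {1..n} \<and> x \<tau> j = y. real_of_int (\<beta> j)) = (\<Sum>j\<in>colliding y. of_int (\<beta> j))"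
    by (intro sum.mono_neutral_right) (auto simp: colliding_def)
  then show ?thesis by (simp only: conserved net_def of_int_sum)
qed

text \<open>This is \<open>regroup\<close> with a step function of the position as weight.\<close>

lemma left_at: "(\<Sum>j | j \<in> {1..n} \<and> x \<tau> j < y. b \<tau> j) = of_int (left_sum y)"
proof -
  have "(\<Sum>j | j \<in> {1..n} \<and> x \<tau> j < y. c j) = (\<Sum>j=1..n. c j * (if x \<tau> j < y then 1 else 0))"
    for c :: "nat \<Rightarrow> real"
    by (simp only: sum.inter_filter finite_atLeastAtMost) (auto intro: sum.cong)
  then show ?thesis
    using regroup[of "\<lambda>v. if v < y then 1 else 0"] by (simp only: left_sum_def of_int_sum)
qed

text \<open>Charged particles have distinct positions at time \<open>\<tau>\<close>, so at most one
  of those at \<open>y\<close> is still charged. On whichever side of the point it moves, the group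
  contributes \<open>0\<close> or \<open>net y\<close>, and both are at most
  \<open>top_psum y\<close>.\<close>

lemma u_after:
  "\<forall>\<^sub>F q in nhds (\<tau>, y). \<tau> \<le> fst q \<longrightarrow> u q \<le> peak y"
  using separated
proof eventually_elim
  case (elim q)
  show ?case
  proof
    assume "\<tau> \<le> fst q"
    with elim have t: "fst q \<in> {\<tau>..<\<tau> + \<delta>}" by auto
    let ?G = "{j. j \<in> {1..n} \<and> x \<tau> j = y}" and ?A = "{j. j \<in> {1..n} \<and> x \<tau> j = y \<and> x (fst q) j \<le> snd q}"
    have same: "j = k" if "j \<in> ?G" "k \<in> ?G" "b \<tau> j \<noteq> 0" "b \<tau> k \<noteq> 0" for j k
      using config that unfolding configs_def
      by (auto simp: split_beta) (metis atLeastAtMost_iff less_irrefl nat_neq_iff)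
    have "(\<Sum>j\<in>?A. b \<tau> j) = 0 \<or> (\<Sum>j\<in>?A. b \<tau> j) = (\<Sum>j\<in>?G. b \<tau> j)"
    proof (cases "\<exists>k\<in>?A. b \<tau> k \<noteq> 0")
      case True
      then have "(\<Sum>j\<in>?A. b \<tau> j) = (\<Sum>j\<in>?G. b \<tau> j)"
        using same by (intro sum.mono_neutral_left) auto
      then show ?thesis ..
    next
      case False
      then show ?thesis by (intro disjI1 sum.neutral) auto
    qed
    then have le: "(\<Sum>j\<in>?A. b \<tau> j) \<le> of_int (top_psum y)"
      using top_bounds[of y] by (elim disjE) (simp_all only: net_at of_int_le_iff of_int_0_le_iff)
    have "u q = (1 / real n) * (\<Sum>j=1..n. b (fst q) j * heaviside (snd q - x (fst q) j))"
      by (simp add: u_n_def split: prod.split)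
    also have "(\<Sum>j=1..n. b (fst q) j * heaviside (snd q - x (fst q) j)) =
        (\<Sum>j=1..n. b \<tau> j * heaviside (snd q - x (fst q) j))"
      using after[OF t] by (intro sum.cong) auto
    also have "\<dots> = (\<Sum>j | j \<in> {1..n} \<and> x \<tau> j < y. b \<tau> j) + (\<Sum>j\<in>?A. b \<tau> j)"
      using elim by (intro heaviside_sum) auto
    also have "(1 / real n) * \<dots> \<le> peak y"
      unfolding peak_def using le by (intro mult_left_mono) (simp_all only: left_at of_int_add, auto)
    finally show "u q \<le> peak y" .
  qed
qed

lemma u_le_peak: "\<forall>\<^sub>F q in nhds (\<tau>, y). u q \<le> peak y"
  using u_after u_before separated
proof eventually_elim
  case (elim q)
  show ?case
  proof (cases "fst q < \<tau>")
    case True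
    with elim(3) have "fst q \<in> {\<tau> - \<delta><..<\<tau>}" by auto
    then obtain k where "(\<Sum>j | j \<in> colliding y \<and> x (fst q) j \<le> snd q. \<beta> j) = psum y k"
      using initial_segment by blast
    then have "u q = (1 / real n) * of_int (left_sum y + psum y k)"
      using elim(2) True by simp
    also have "\<dots> \<le> peak y"
      unfolding peak_def by (intro mult_left_mono) (use psum_le_top in auto)
    finally show ?thesis .
  qed (use elim(1) in auto)
qed

section \<open>Velocities of colliding particles\<close>

text \<open>The summand with \<open>j = i\<close> is a division by zero and hence \<open>0\<close>,
  so the index set need not depend on \<open>i\<close>.\<close>

definition pull :: "real \<Rightarrow> nat \<Rightarrow> real \<Rightarrow> real"
  where "pull y i t = (\<Sum>j\<in>colliding y. of_int (\<beta> j) / (x t i - x t j))"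

definition ext :: "real \<Rightarrow> nat \<Rightarrow> real \<Rightarrow> real"
  where "ext y i t = (\<Sum>j | j \<in> {1..n} \<and> x \<tau> j \<noteq> y. of_int (\<beta> j) / (x t i - x t j))"

lemma near_before: "\<forall>\<^sub>F t in at_left \<tau>. t \<in> {\<tau> - \<delta><..<\<tau>}"
  using \<delta> unfolding eventually_at_left_field by (intro exI[of _ "\<tau> - \<delta>"]) auto

lemma charge_colliding: "i \<in> colliding y \<Longrightarrow> \<beta> i = 1 \<or> \<beta> i = -1"
  using charge[of i] by (auto simp: colliding_def)

lemma velocity:
  assumes t: "t \<in> {\<tau> - \<delta><..<\<tau>}" and i: "i \<in> colliding y"
  shows "((\<lambda>s. x s i) has_real_derivative of_int (\<beta> i) * (1 / real n) * (pull y i t + ext y i t)) (at t)"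
proof -
  let ?f = "\<lambda>j. of_int (\<beta> j) / (x t i - x t j)" and ?X = "{j. j \<in> {1..n} \<and> x \<tau> j \<noteq> y}"
  have "(\<Sum>j\<in>{1..n} - {i}. ?f j) = (\<Sum>j\<in>{1..n}. ?f j)"
    by (rule sum.mono_neutral_left) auto
  also have "\<dots> = (\<Sum>j\<in>colliding y \<union> ?X. ?f j)"
    by (rule sum.mono_neutral_right) (auto simp: colliding_def)
  also have "\<dots> = pull y i t + ext y i t"
    unfolding pull_def ext_def by (rule sum.union_disjoint) (auto simp: colliding_def)
  finally have "(\<Sum>j\<in>{1..n} - {i}. of_int (\<beta> i) * of_int (\<beta> j) / (x t i - x t j)) =
      of_int (\<beta> i) * (pull y i t + ext y i t)"
    by (metis (no_types, lifting) sum.cong sum_distrib_left times_divide_eq_right)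
  then show ?thesis
    using ode[OF t colliding(2)[OF i]] by (simp add: mult_ac)
qed

lemma position_tendsto: "j \<in> {1..n} \<Longrightarrow> ((\<lambda>t. x t j) \<longlongrightarrow> x \<tau> j) (at_left \<tau>)"
  using cont[of j] by (simp add: isCont_def filterlim_at_split)

lemma ext_tendsto:
  assumes "i \<in> colliding y"
  shows "((\<lambda>t. (1 / real n) * ext y i t) \<longlongrightarrow> force y) (at_left \<tau>)"
proof -
  have "((\<lambda>t. of_int (\<beta> j) / (x t i - x t j)) \<longlongrightarrow> of_int (\<beta> j) / (y - x \<tau> j)) (at_left \<tau>)"
    if "j \<in> {j. j \<in> {1..n} \<and> x \<tau> j \<noteq> y}" for j
  proof -
    have "((\<lambda>t. x t i) \<longlongrightarrow> y) (at_left \<tau>)"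
      using position_tendsto[of i] colliding(2,3)[OF assms] by simp
    with that show ?thesis
      by (intro tendsto_divide tendsto_diff tendsto_const position_tendsto) auto
  qed
  then show ?thesis
    unfolding ext_def force_def by (intro tendsto_mult tendsto_const tendsto_sum)
qed

lemma order_iff:
  assumes "t \<in> {\<tau> - \<delta><..<\<tau>}" "i \<in> colliding y" "j \<in> colliding y"
  shows "x t i \<le> x t j \<longleftrightarrow> i \<le> j"
  using ordered[OF assms(1), of i j] ordered[OF assms(1), of j i] colliding(2,4)[OF assms(2)]
    colliding(2,4)[OF assms(3)]
  by (cases i j rule: linorder_cases) auto

lemma inj_on_colliding:
  assumes "t \<in> {\<tau> - \<delta><..<\<tau>}"
  shows "inj_on (x t) (colliding y)"
  using order_iff[OF assms] by (intro inj_onI) (metis order_antisym order_refl)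

lemma psum_diff:
  assumes "k \<le> l"
  shows "(\<Sum>j | j \<in> colliding y \<and> k \<le> j \<and> j < l. \<beta> j) = psum y l - psum y k"
proof -
  let ?A = "{j. j \<in> colliding y \<and> j < k}" and ?B = "{j. j \<in> colliding y \<and> k \<le> j \<and> j < l}"
  have "psum y l = sum \<beta> (?A \<union> ?B)"
    unfolding psum_def using assms by (intro sum.cong) auto
  also have "\<dots> = psum y k + sum \<beta> ?B"
    unfolding psum_def using colliding(1) by (intro sum.union_disjoint) auto
  finally show ?thesis by simp
qed

text \<open>
  Abel summation over the distances to particle \<open>i\<close>: if the partial sum of charges is maximal next
  to \<open>i\<close>, then the other colliding particles push \<open>i\<close> in the direction of its charge.
\<close>

lemma pull_ge:
  assumes t: "t \<in> {\<tau> - \<delta><..<\<tau>}" and i: "i \<in> colliding y"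
    and left: "\<And>k. k < i \<Longrightarrow> psum y k \<le> psum y i"
    and right: "\<And>k. i < k \<Longrightarrow> psum y k \<le> psum y (Suc i)"
    and R: "\<And>j. j \<in> colliding y \<Longrightarrow> \<bar>x t i - x t j\<bar> \<le> R"
  shows "of_int (psum y i + psum y (Suc i) - net y) / R \<le> pull y i t"
proof -
  let ?L = "{j. j \<in> colliding y \<and> j < i}" and ?R = "{j. j \<in> colliding y \<and> Suc i \<le> j \<and> j < Suc n}"
  have less: "x t j < x t k \<longleftrightarrow> j < k" if "j \<in> colliding y" "k \<in> colliding y" for j k
    using order_iff[OF t that(2,1)] by auto
  have "(\<Sum>j\<in>?L. - real_of_int (\<beta> j) / (x t i - x t j)) \<le> (\<Sum>j\<in>?L. - real_of_int (\<beta> j)) / R"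
  proof (rule abel_inverse_sum_le)
    show "inj_on (\<lambda>j. x t i - x t j) ?L"
      using inj_on_colliding[OF t, of y] by (auto simp: inj_on_def)
    show "0 < x t i - x t j \<and> x t i - x t j \<le> R" if "j \<in> ?L" for j
      using that R[of j] less[of j i] i by auto
    \<comment> \<open>The particles no farther from \<open>i\<close> than \<open>k\<close> are those
      with indices from \<open>k\<close> to \<open>i - 1\<close>, and their charges add up to
      \<open>psum y i - psum y k\<close>.\<close>
    show "(\<Sum>j | j \<in> ?L \<and> x t i - x t j \<le> x t i - x t k. - real_of_int (\<beta> j)) \<le> 0" if k: "k \<in> ?L" for k
    proof -
      have "{j. j \<in> ?L \<and> x t i - x t j \<le> x t i - x t k} = {j. j \<in> colliding y \<and> k \<le> j \<and> j < i}"
        using k order_iff[OF t, of k y] by auto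
      then have "(\<Sum>j | j \<in> ?L \<and> x t i - x t j \<le> x t i - x t k. - real_of_int (\<beta> j)) =
          - of_int (psum y i - psum y k)"
        using psum_diff[of k i y] k by (simp only: sum_negf flip: of_int_sum) simp
      then show ?thesis using left[of k] k by simp
    qed
  qed (use colliding(1) in auto)
  moreover have "(\<Sum>j\<in>?R. real_of_int (\<beta> j) / (x t j - x t i)) \<le> (\<Sum>j\<in>?R. real_of_int (\<beta> j)) / R"
  proof (rule abel_inverse_sum_le)
    show "inj_on (\<lambda>j. x t j - x t i) ?R"
      using inj_on_colliding[OF t, of y] by (auto simp: inj_on_def)
    show "0 < x t j - x t i \<and> x t j - x t i \<le> R" if "j \<in> ?R" for j
      using that R[of j] less[of i j] i by auto
    show "(\<Sum>j | j \<in> ?R \<and> x t j - x t i \<le> x t k - x t i. real_of_int (\<beta> j)) \<le> 0" if k: "k \<in> ?R" for k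
    proof -
      have "{j. j \<in> ?R \<and> x t j - x t i \<le> x t k - x t i} = {j. j \<in> colliding y \<and> Suc i \<le> j \<and> j < Suc k}"
        using k order_iff[OF t, of _ y k] by auto
      then have "(\<Sum>j | j \<in> ?R \<and> x t j - x t i \<le> x t k - x t i. real_of_int (\<beta> j)) =
          of_int (psum y (Suc k) - psum y (Suc i))"
        using psum_diff[of "Suc i" "Suc k" y] k by (simp only: flip: of_int_sum) simp
      then show ?thesis using right[of "Suc k"] k by simp
    qed
  qed (use colliding(1) in auto)
  moreover have "pull y i t = - (\<Sum>j\<in>?L. - real_of_int (\<beta> j) / (x t i - x t j))
      - (\<Sum>j\<in>?R. real_of_int (\<beta> j) / (x t j - x t i))"
  proof -
    have "j = i" if "j \<in> colliding y - (?L \<union> ?R)" for j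
      using that colliding(2)[of j y] by auto
    then have "pull y i t = (\<Sum>j\<in>?L \<union> ?R. of_int (\<beta> j) / (x t i - x t j))"
      unfolding pull_def using colliding(1) by (intro sum.mono_neutral_right) auto
    also have "\<dots> = (\<Sum>j\<in>?L. of_int (\<beta> j) / (x t i - x t j)) + (\<Sum>j\<in>?R. of_int (\<beta> j) / (x t i - x t j))"
      using colliding(1) by (intro sum.union_disjoint) auto
    also have "(\<Sum>j\<in>?R. of_int (\<beta> j) / (x t i - x t j)) = (\<Sum>j\<in>?R. - (of_int (\<beta> j) / (x t j - x t i)))"
      by (intro sum.cong refl) (metis minus_diff_eq minus_divide_right)
    finally show ?thesis by (simp add: sum_negf)
  qed
  moreover have "(\<Sum>j\<in>?L. - real_of_int (\<beta> j)) = - of_int (psum y i)"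
    using psum_diff[of 0 i y] by (simp add: sum_negf flip: of_int_sum)
  moreover have "(\<Sum>j\<in>?R. real_of_int (\<beta> j)) = of_int (net y - psum y (Suc i))"
    using psum_diff[of "Suc i" "Suc n" y] colliding(2)[OF i] by (simp add: psum_net flip: of_int_sum)
  ultimately show ?thesis
    by (simp add: diff_divide_distrib add_divide_distrib)
qed

text \<open>The exterior particles contribute a velocity tending to \<open>force y\<close>. The pull
  is at least the excess of the partial sums divided by any bound on the mutual distances, which
  tend to \<open>0\<close>: it is nonnegative in general and exceeds every constant if the excess is
  positive.\<close>

lemma speed:
  assumes i: "i \<in> colliding y"
    and left: "\<And>k. k < i \<Longrightarrow> psum y k \<le> psum y i"
    and right: "\<And>k. i < k \<Longrightarrow> psum y k \<le> psum y (Suc i)"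
    and excess: "net y \<le> psum y i + psum y (Suc i)"
    and L: "L < force y \<or> net y < psum y i + psum y (Suc i)"
  shows "\<forall>\<^sub>F t in at_left \<tau>. L * (\<tau> - t) \<le> of_int (\<beta> i) * (y - x t i)"
proof -
  \<comment> \<open>\<open>K\<close> is the velocity that the pull has to supply beyond the exterior
    force. The excess is an integer, so when positive it is at least \<open>1\<close>, and distances
    below \<open>R\<close> then give a pull of at least \<open>n * (K + 1)\<close>.\<close>
  define K where "K = (if L < force y then 0 else L - force y + 1)"
  have K: "K \<ge> 0" "L - K < force y" by (auto simp: K_def)
  define R where "R = 1 / (real n * (K + 1))"
  have R: "R > 0" using K n_pos by (simp add: R_def)
  have close: "\<forall>\<^sub>F t in at_left \<tau>. \<forall>j\<in>colliding y. \<bar>x t i - x t j\<bar> \<le> R"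
  proof (intro eventually_ball_finite ballI colliding(1))
    fix j assume j: "j \<in> colliding y"
    have "((\<lambda>t. \<bar>x t i - x t j\<bar>) \<longlongrightarrow> \<bar>x \<tau> i - x \<tau> j\<bar>) (at_left \<tau>)"
      by (intro tendsto_intros position_tendsto colliding(2)[OF i] colliding(2)[OF j])
    then have "\<forall>\<^sub>F t in at_left \<tau>. \<bar>x t i - x t j\<bar> < R"
      using R colliding(3)[OF i] colliding(3)[OF j] by (intro order_tendstoD(2)) auto
    then show "\<forall>\<^sub>F t in at_left \<tau>. \<bar>x t i - x t j\<bar> \<le> R"
      by eventually_elim simp
  qed
  have "\<forall>\<^sub>F t in at_left \<tau>. L - K < (1 / real n) * ext y i t"
    using ext_tendsto[OF i] K(2) by (rule order_tendstoD)
  with close near_before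
  have "\<forall>\<^sub>F t in at_left \<tau>. ((\<lambda>s. of_int (\<beta> i) * x s i) has_real_derivative
      (1 / real n) * (pull y i t + ext y i t)) (at t) \<and> L \<le> (1 / real n) * (pull y i t + ext y i t)"
  proof eventually_elim
    case (elim t)
    have sq: "real_of_int (\<beta> i) * real_of_int (\<beta> i) = 1"
      using charge_colliding[OF i] by auto
    have "of_int (psum y i + psum y (Suc i) - net y) / R \<le> pull y i t"
      using elim by (intro pull_ge i left right) auto
    moreover have "K * n \<le> of_int (psum y i + psum y (Suc i) - net y) / R"
    proof (cases "L < force y")
      case True
      then show ?thesis using R excess by (simp add: K_def)
    next
      case False
      then have "1 \<le> psum y i + psum y (Suc i) - net y" using L by linarith
      then have "1 / R \<le> of_int (psum y i + psum y (Suc i) - net y) / R"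
        using R by (intro divide_right_mono) (simp_all only: of_int_1_le_iff)
      then show ?thesis by (simp add: R_def algebra_simps)
    qed
    ultimately have "K \<le> (1 / real n) * pull y i t"
      using n_pos by (simp add: field_simps)
    then have "L \<le> (1 / real n) * (pull y i t + ext y i t)"
      using elim(3) by (simp add: algebra_simps)
    moreover have "((\<lambda>s. of_int (\<beta> i) * x s i) has_real_derivative
        of_int (\<beta> i) * (of_int (\<beta> i) * (1 / real n) * (pull y i t + ext y i t))) (at t)"
      using elim by (intro DERIV_cmult velocity i) auto
    ultimately show ?case
      using sq by (simp flip: mult.assoc)
  qed
  moreover have "isCont (\<lambda>s. of_int (\<beta> i) * x s i) \<tau>"
    using colliding(2)[OF i] by (intro continuous_intros cont)
  ultimately have "\<forall>\<^sub>F t in at_left \<tau>. L * (\<tau> - t) \<le> of_int (\<beta> i) * x \<tau> i - of_int (\<beta> i) * x t i"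
    by (rule past_growth)
  then show ?thesis
    using colliding(3)[OF i] by (simp add: algebra_simps)
qed

text \<open>
  The derivative of the moment of inertia of the colliding particles stays bounded, because in it
  the singular pair interactions add up to the constant \<open>\<Sum>\<beta> i \<beta> j\<close>.
\<close>

lemma colliding_rate:
  assumes i: "i \<in> colliding y"
  shows "\<forall>\<^sub>F t in at_left \<tau>. (x t i - y)\<^sup>2 \<le> real (n + 1) * (\<tau> - t)"
proof -
  let ?I = "colliding y"
  let ?M' = "\<lambda>t. \<Sum>i\<in>?I. 2 * (x t i - y) * (of_int (\<beta> i) * (1 / real n) * (pull y i t + ext y i t))"
  have lim: "((\<lambda>t. \<Sum>i\<in>?I. 2 * (x t i - y) * (of_int (\<beta> i) * ((1 / real n) * ext y i t))) \<longlongrightarrow>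
      (\<Sum>i\<in>?I. 2 * (x \<tau> i - y) * (of_int (\<beta> i) * force y))) (at_left \<tau>)"
    by (intro tendsto_intros position_tendsto colliding(2) ext_tendsto)
  have "(\<Sum>i\<in>?I. 2 * (x \<tau> i - y) * (of_int (\<beta> i) * force y)) = 0"
    using colliding(3) by (intro sum.neutral) auto
  \<comment> \<open>The exterior contribution vanishes at \<open>\<tau>\<close>, where all colliding
    particles are at \<open>y\<close>. The bound \<open>- 1\<close> for it and \<open>- n\<close>
    for the pair interactions account for \<open>n + 1\<close>.\<close>
  with lim have "\<forall>\<^sub>F t in at_left \<tau>. -1 < (\<Sum>i\<in>?I. 2 * (x t i - y) * (of_int (\<beta> i) * ((1 / real n) * ext y i t)))"
    by (intro order_tendstoD(1)) auto
  with near_before have "\<forall>\<^sub>F t in at_left \<tau>. ((\<lambda>s. \<Sum>i\<in>?I. (x s i - y)\<^sup>2) has_real_derivative ?M' t) (at t)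
      \<and> - real (n + 1) \<le> ?M' t"
  proof eventually_elim
    case (elim t)
    define f where "f i j = (x t i - y) * of_int (\<beta> i) * (of_int (\<beta> j) / (x t i - x t j))" for i j
    have "- 1 \<le> f i j + f j i" if "i \<in> ?I" "j \<in> ?I" for i j
    proof (cases "i = j")
      case False
      then have "x t i \<noteq> x t j"
        using order_iff[OF elim(1), of i y j] order_iff[OF elim(1), of j y i] that by auto
      then have "f i j + f j i = of_int (\<beta> i) * of_int (\<beta> j)"
        by (simp add: f_def divide_simps) (simp add: algebra_simps)
      then show ?thesis
        using charge_colliding[OF that(1)] charge_colliding[OF that(2)] by auto
    qed (simp add: f_def)
    then have "(\<Sum>i\<in>?I. \<Sum>j\<in>?I. - 1) \<le> (\<Sum>i\<in>?I. \<Sum>j\<in>?I. f i j + f j i)"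
      by (intro sum_mono)
    also have "\<dots> = 2 * (\<Sum>i\<in>?I. \<Sum>j\<in>?I. f i j)"
      using sum.swap[of f ?I ?I] by (simp add: sum.distrib)
    also have "(\<Sum>i\<in>?I. \<Sum>j\<in>?I. f i j) = (\<Sum>i\<in>?I. (x t i - y) * of_int (\<beta> i) * pull y i t)"
      by (simp add: f_def pull_def sum_distrib_left)
    finally have "- (real (card ?I) * real (card ?I)) \<le> 2 * (\<Sum>i\<in>?I. (x t i - y) * of_int (\<beta> i) * pull y i t)"
      by simp
    moreover have "card ?I \<le> card {1..n}"
      by (intro card_mono) (auto simp: colliding_def)
    then have "real (card ?I) * real (card ?I) \<le> real n * real n"
      by (intro mult_mono) auto
    ultimately have "- (real n * real n) \<le> 2 * (\<Sum>i\<in>?I. (x t i - y) * of_int (\<beta> i) * pull y i t)"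
      by linarith
    then have "- real n \<le> (1 / real n) * (2 * (\<Sum>i\<in>?I. (x t i - y) * of_int (\<beta> i) * pull y i t))"
      using n_pos by (simp add: field_simps)
    also have "\<dots> = (\<Sum>i\<in>?I. 2 * (x t i - y) * (of_int (\<beta> i) * (1 / real n) * pull y i t))"
      by (simp only: sum_distrib_left mult_ac)
    finally have "- real (n + 1) \<le> ?M' t"
      using elim(2) by (simp add: distrib_left sum.distrib mult.assoc)
    moreover have "((\<lambda>s. \<Sum>i\<in>?I. (x s i - y)\<^sup>2) has_real_derivative ?M' t) (at t)"
      by (rule DERIV_sum) (auto intro!: derivative_eq_intros velocity[OF elim(1)])
    ultimately show ?case by blast
  qed
  moreover have "isCont (\<lambda>s. \<Sum>i\<in>?I. (x s i - y)\<^sup>2) \<tau>"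
    by (intro continuous_intros cont colliding(2))
  ultimately have "\<forall>\<^sub>F t in at_left \<tau>. - real (n + 1) * (\<tau> - t) \<le>
      (\<Sum>i\<in>?I. (x \<tau> i - y)\<^sup>2) - (\<Sum>i\<in>?I. (x t i - y)\<^sup>2)"
    by (rule past_growth)
  then show ?thesis
  proof eventually_elim
    case (elim t)
    have "(\<Sum>i\<in>?I. (x \<tau> i - y)\<^sup>2) = 0"
      using colliding(3) by (intro sum.neutral) auto
    moreover have "(x t i - y)\<^sup>2 \<le> (\<Sum>i\<in>?I. (x t i - y)\<^sup>2)"
      using i colliding(1) by (intro member_le_sum) auto
    ultimately show ?case using elim unfolding mult_minus_left by linarith
  qed
qed

section \<open>Test functions along particle paths\<close>

text \<open>Just before \<open>\<tau>\<close> the value \<open>peak y\<close> is taken at particle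
  \<open>i\<close> or immediately to its left. In the second case it is carried over to
  \<open>\<phi>\<close> at the particle by continuity.\<close>

lemma touching_peak:
  assumes i: "i \<in> colliding y" and top: "psum y i = top_psum y \<or> psum y (Suc i) = top_psum y"
    and le: "\<And>q. q \<in> Q \<Longrightarrow> u q \<le> \<phi> q + c" and \<phi>: "\<And>q. q \<in> Q \<Longrightarrow> isCont \<phi> q"
  shows "\<forall>\<^sub>F t in at_left \<tau>. peak y \<le> \<phi> (t, x t i) + c"
proof -
  have "((\<lambda>t. (t, x t i)) \<longlongrightarrow> (\<tau>, y)) (at_left \<tau>)"
    using position_tendsto[of i] colliding(2,3)[OF i] by (intro tendsto_intros) auto
  \<comment> \<open>The formula for \<open>u\<close> is needed in a whole neighbourhood of each
    point of the path, so that the particle can be approached from the left.\<close>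
  moreover have "\<forall>\<^sub>F q in nhds (\<tau>, y). \<forall>\<^sub>F q' in nhds q. fst q' < \<tau> \<longrightarrow>
    u q' = (1 / real n) * of_int (left_sum y + (\<Sum>j | j \<in> colliding y \<and> x (fst q') j \<le> snd q'. \<beta> j))"
    using u_before by (simp add: eventually_eventually)
  ultimately have "\<forall>\<^sub>F t in at_left \<tau>. \<forall>\<^sub>F q' in nhds (t, x t i). fst q' < \<tau> \<longrightarrow>
    u q' = (1 / real n) * of_int (left_sum y + (\<Sum>j | j \<in> colliding y \<and> x (fst q') j \<le> snd q'. \<beta> j))"
    by (rule eventually_compose_filterlim[rotated])
  then show ?thesis
    using near_before
  proof eventually_elim
    case (elim t)
    then have Q: "(t, z) \<in> Q" for z
      using \<delta> by (simp add: Q_def)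
    show ?case
      using top
    proof
      assume top: "psum y (Suc i) = top_psum y"
      have "{j. j \<in> colliding y \<and> x t j \<le> x t i} = {j. j \<in> colliding y \<and> j < Suc i}"
        using order_iff[OF elim(2) _ i] by (auto simp: less_Suc_eq_le)
      then have "u (t, x t i) = peak y"
        using eventually_nhds_x_imp_x[OF elim(1)] elim(2)
        unfolding peak_def top[symmetric] psum_def by simp
      then show ?thesis using le[OF Q] by metis
    next
      assume top: "psum y i = top_psum y"
      have "((\<lambda>z. (t, z)) \<longlongrightarrow> (t, x t i)) (at_left (x t i))"
        by (intro tendsto_intros)
      from eventually_compose_filterlim[OF elim(1) this]
      have "\<forall>\<^sub>F z in at_left (x t i). u (t, z) =
          (1 / real n) * of_int (left_sum y + (\<Sum>j | j \<in> colliding y \<and> x t j \<le> z. \<beta> j))"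
        using elim(2) by simp
      moreover have "\<forall>\<^sub>F z in at_left (x t i). \<forall>j\<in>colliding y. j < i \<longrightarrow> x t j < z"
      proof (intro eventually_ball_finite ballI colliding(1))
        fix j assume j: "j \<in> colliding y"
        show "\<forall>\<^sub>F z in at_left (x t i). j < i \<longrightarrow> x t j < z"
          using order_iff[OF elim(2) i j] by (auto simp: eventually_at_left_field not_le)
      qed
      moreover have "\<forall>\<^sub>F z in at_left (x t i). z < x t i"
        by (simp add: eventually_at_filter)
      ultimately have "\<forall>\<^sub>F z in at_left (x t i). peak y \<le> \<phi> (t, z) + c"
      proof eventually_elim
        case z: (elim z)
        have "{j. j \<in> colliding y \<and> x t j \<le> z} = {j. j \<in> colliding y \<and> j < i}"
          using order_iff[OF elim(2) i] z(2,3) by (force simp: not_le[symmetric])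
        then have "u (t, z) = peak y"
          using z(1) unfolding peak_def top[symmetric] psum_def by simp
        then show ?case using le[OF Q] by metis
      qed
      moreover have "((\<lambda>z. \<phi> (t, z) + c) \<longlongrightarrow> \<phi> (t, x t i) + c) (at_left (x t i))"
        by (intro tendsto_intros isCont_tendsto_compose[OF \<phi>[OF Q]])
      ultimately show ?thesis
        by (intro tendsto_lowerbound[of _ _ "at_left (x t i)"]) auto
    qed
  qed
qed

text \<open>Without charged particles at \<open>y\<close>, \<open>u\<close> is constant near
  \<open>(\<tau>, y)\<close> before \<open>\<tau>\<close>, and the line \<open>x = y\<close>
  replaces a particle path.\<close>

lemma touching_alone:
  assumes "colliding y = {}" and le: "\<And>q. q \<in> Q \<Longrightarrow> u q \<le> \<phi> q + c"
  shows "\<forall>\<^sub>F t in at_left \<tau>. peak y \<le> \<phi> (t, y) + c"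
proof -
  have "psum y k = 0" for k
    using assms(1) by (simp add: psum_def)
  then have top: "top_psum y = 0"
    using top_attained by metis
  have "((\<lambda>t. (t, y)) \<longlongrightarrow> (\<tau>, y)) (at_left \<tau>)"
    by (intro tendsto_intros)
  from eventually_compose_filterlim[OF u_before this]
  have "\<forall>\<^sub>F t in at_left \<tau>. t < \<tau> \<longrightarrow> u (t, y) = (1 / real n) * of_int (left_sum y)"
    using assms(1) by simp
  then show ?thesis
    using near_before
  proof eventually_elim
    case (elim t)
    then show ?case
      using le[of "(t, y)"] \<delta> top by (simp add: peak_def Q_def)
  qed
qed

end

subsection \<open>Principal value integrals and test functions\<close>

lemma integral_inverse_square_right:
  assumes a: "(a::real) > 0"
  shows "has_bochner_integral lborel (\<lambda>z. indicator {a..} z * (1 / z\<^sup>2)) (1 / a)"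
proof -
  have "((\<lambda>z::real. - 1 / z) \<longlongrightarrow> 0) at_top"
    by (rule real_tendsto_divide_at_top[OF tendsto_const filterlim_ident])
  then have "(\<integral>\<^sup>+ z. ennreal (1 / z\<^sup>2) * indicator {a..} z \<partial>lborel) = ennreal (0 - (- 1 / a))"
    using a by (intro nn_integral_FTC_atLeast)
      (auto intro!: derivative_eq_intros simp: power2_eq_square divide_simps)
  moreover have "(\<integral>\<^sup>+ z. ennreal (indicator {a..} z * (1 / z\<^sup>2)) \<partial>lborel) =
      (\<integral>\<^sup>+ z. ennreal (1 / z\<^sup>2) * indicator {a..} z \<partial>lborel)"
    by (intro nn_integral_cong) (auto simp: indicator_def)
  ultimately show ?thesis
    using a by (intro has_bochner_integral_nn_integral) auto
qed

lemma has_bochner_integral_uminus_arg: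
  fixes f :: "real \<Rightarrow> real"
  shows "has_bochner_integral lborel f v \<Longrightarrow> has_bochner_integral lborel (\<lambda>z. f (- z)) v"
  using lborel_has_bochner_integral_real_affine_iff[of "-1" f v 0] by simp

text \<open>The closed half-line belongs to the complement of a ball; the open one is where a
  right-continuous step has not yet jumped.\<close>

lemma integral_inverse_square_left:
  assumes a: "(a::real) > 0"
  shows "has_bochner_integral lborel (\<lambda>z. indicator {..- a} z * (1 / z\<^sup>2)) (1 / a)"
    and "has_bochner_integral lborel (\<lambda>z. indicator {..<- a} z * (1 / z\<^sup>2)) (1 / a)"
proof -
  have "(\<lambda>z. indicator {a..} (- z) * (1 / (- z)\<^sup>2)) = (\<lambda>z. indicator {..- a} z * (1 / z\<^sup>2))"
    by (auto simp: indicator_def)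
  then show *: "has_bochner_integral lborel (\<lambda>z. indicator {..- a} z * (1 / z\<^sup>2)) (1 / a)"
    using has_bochner_integral_uminus_arg[OF integral_inverse_square_right[OF a]] by simp
  show "has_bochner_integral lborel (\<lambda>z. indicator {..<- a} z * (1 / z\<^sup>2)) (1 / a)"
    using * by (subst has_bochner_integral_discrete_difference[where X="{- a}" and g="\<lambda>z. indicator {..- a} z * (1 / z\<^sup>2)"])
      (auto simp: indicator_def)
qed

lemma set_integrable_over_square:
  fixes h :: "real \<Rightarrow> real"
  assumes r: "r > 0" and h: "h \<in> borel_measurable borel" and B: "\<And>z. \<bar>h z\<bar> \<le> B"
  shows "set_integrable lborel (- ball 0 r) (\<lambda>z. h z / z\<^sup>2)"
  unfolding set_integrable_def
proof (rule Bochner_Integration.integrable_bound)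
  show "integrable lborel (\<lambda>z. B * (indicator {r..} z * (1 / z\<^sup>2) + indicator {..- r} z * (1 / z\<^sup>2)))"
    using integral_inverse_square_right[OF r] integral_inverse_square_left(1)[OF r]
    by (intro integrable_mult_right Bochner_Integration.integrable_add) (auto dest: integrable.intros)
  show "(\<lambda>z. indicator (- ball 0 r) z *\<^sub>R (h z / z\<^sup>2)) \<in> borel_measurable lborel"
    using h by measurable
  have "\<bar>h z / z\<^sup>2\<bar> \<le> B * (1 / z\<^sup>2)" for z
    using B[of z] by (simp add: divide_right_mono)
  moreover have "B \<ge> 0" using B[of 0] by linarith
  ultimately show "AE z in lborel. norm (indicator (- ball 0 r) z *\<^sub>R (h z / z\<^sup>2)) \<le>
      norm (B * (indicator {r..} z * (1 / z\<^sup>2) + indicator {..- r} z * (1 / z\<^sup>2)))"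
    using r by (intro AE_I2) (auto simp: indicator_def dist_real_def abs_mult)
qed

lemma E_upper_near: "\<epsilon> > 0 \<Longrightarrow> \<bar>E_upper \<epsilon> \<alpha> - \<alpha>\<bar> \<le> \<epsilon>"
proof -
  assume \<epsilon>: "\<epsilon> > 0"
  have "\<bar>of_int \<lfloor>\<alpha> / \<epsilon>\<rfloor> + 1 / 2 - \<alpha> / \<epsilon>\<bar> \<le> 1"
    by linarith
  then have "\<epsilon> * \<bar>of_int \<lfloor>\<alpha> / \<epsilon>\<rfloor> + 1 / 2 - \<alpha> / \<epsilon>\<bar> \<le> \<epsilon> * 1"
    using \<epsilon> by (intro mult_left_mono) auto
  moreover have "\<epsilon> * \<bar>of_int \<lfloor>\<alpha> / \<epsilon>\<rfloor> + 1 / 2 - \<alpha> / \<epsilon>\<bar> = \<bar>E_upper \<epsilon> \<alpha> - \<alpha>\<bar>"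
    using \<epsilon> by (subst abs_of_pos[OF \<epsilon>, symmetric], subst abs_mult[symmetric])
      (simp add: E_upper_def E_def algebra_simps)
  ultimately show ?thesis by simp
qed

lemma set_integrable_annulus:
  fixes g :: "real \<Rightarrow> real"
  assumes r: "r > 0" and \<epsilon>: "\<epsilon> > 0" and g: "continuous_on UNIV g"
  shows "set_integrable lborel (ball 0 \<rho> - ball 0 r) (\<lambda>z. E_upper \<epsilon> (g z) / z\<^sup>2)"
proof -
  have "compact (g ` cball 0 \<rho>)"
    using g by (intro compact_continuous_image) (auto intro: continuous_on_subset)
  then obtain B where B: "\<And>z. z \<in> cball 0 \<rho> \<Longrightarrow> \<bar>g z\<bar> \<le> B"
    using compact_imp_bounded[of "g ` cball 0 \<rho>"] unfolding bounded_iff real_norm_def by blast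
  define C where "C = B + \<epsilon>"
  \<comment> \<open>Truncation at \<open>C\<close> changes nothing on the ball and produces a
    globally bounded function.\<close>
  define h where "h z = max (- C) (min C (E_upper \<epsilon> (g z)))" for z
  have h: "h z = E_upper \<epsilon> (g z)" if "z \<in> ball 0 \<rho>" for z
    using B[of z] E_upper_near[OF \<epsilon>, of "g z"] that unfolding C_def h_def by auto
  have "(\<lambda>z. E_upper \<epsilon> (g z)) \<in> borel_measurable borel"
    by (rule measurable_compose[OF borel_measurable_continuous_onI[OF g] E_upper_measurable[OF \<epsilon>]])
  then have "h \<in> borel_measurable borel"
    unfolding h_def by measurable
  moreover have "\<bar>h z\<bar> \<le> \<bar>C\<bar>" for z
    by (auto simp: h_def)
  ultimately have "set_integrable lborel (- ball 0 r) (\<lambda>z. h z / z\<^sup>2)"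
    using r by (intro set_integrable_over_square)
  then have "set_integrable lborel (ball 0 \<rho> - ball 0 r) (\<lambda>z. h z / z\<^sup>2)"
    by (rule set_integrable_subset) auto
  then show ?thesis
    unfolding set_integrable_def
    by (rule iffD1[OF Bochner_Integration.integrable_cong, rotated -1]) (auto simp: h indicator_def)
qed

lemma E_upper_sgn:
  assumes "\<epsilon> > 0" "\<alpha> \<noteq> 0" "\<bar>\<alpha>\<bar> < \<epsilon>"
  shows "E_upper \<epsilon> \<alpha> = sgn \<alpha> * (\<epsilon> / 2)"
proof (cases "\<alpha> > 0")
  case True
  then have "\<lfloor>\<alpha> / \<epsilon>\<rfloor> = 0"
    using assms by (intro floor_unique) auto
  then show ?thesis using True by (simp add: E_upper_def E_def)
next
  case False
  then have "\<lfloor>\<alpha> / \<epsilon>\<rfloor> = -1"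
    using assms by (intro floor_unique) (auto simp: field_simps)
  then show ?thesis using False assms(2) by (simp add: E_upper_def E_def)
qed

text \<open>
  Near \<open>0\<close> the integrand is odd, so that the truncated integrals do not depend on the truncation
  radius as long as it is small.
\<close>

lemma pv_tendsto:
  fixes g :: "real \<Rightarrow> real"
  assumes \<epsilon>: "\<epsilon> > 0" and g: "continuous_on UNIV g" and g0: "g 0 = 0"
    and der: "(g has_real_derivative c) (at 0)" and c: "c \<noteq> 0" and R: "R > 0"
  obtains r where "0 < r" "r < R"
    "((\<lambda>s. LINT z:ball 0 \<rho> - ball 0 s|lborel. E_upper \<epsilon> (g z) / z\<^sup>2) \<longlongrightarrow>
      (LINT z:ball 0 \<rho> - ball 0 r|lborel. E_upper \<epsilon> (g z) / z\<^sup>2)) (at_right 0)"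
proof -
  let ?f = "\<lambda>z. E_upper \<epsilon> (g z) / z\<^sup>2"
  \<comment> \<open>Near \<open>0\<close> the product is positive, which says that
    \<open>g z\<close> and \<open>c * z\<close> have the same sign, for either sign of
    \<open>c\<close>.\<close>
  have "((\<lambda>z. g z / z * c) \<longlongrightarrow> c * c) (at 0)"
    using der g0 by (intro tendsto_intros) (simp add: has_field_derivative_iff)
  then have "\<forall>\<^sub>F z in at 0. 0 < g z / z * c"
    using c by (intro order_tendstoD) (auto simp: zero_less_mult_iff)
  moreover have "((\<lambda>z. \<bar>g z\<bar>) \<longlongrightarrow> \<bar>g 0\<bar>) (at 0)"
    using DERIV_isCont[OF der] by (intro tendsto_intros) (simp add: isCont_def)
  then have "\<forall>\<^sub>F z in at 0. \<bar>g z\<bar> < \<epsilon>"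
    using \<epsilon> g0 by (intro order_tendstoD) auto
  ultimately have "\<forall>\<^sub>F z in at 0. ?f z = sgn (c * z) * (\<epsilon> / 2) / z\<^sup>2"
  proof eventually_elim
    case (elim z)
    then have "g z \<noteq> 0" "sgn (g z) = sgn (c * z)"
      by (auto simp: zero_less_mult_iff zero_less_divide_iff mult_less_0_iff sgn_if split: if_splits)
    with elim E_upper_sgn[OF \<epsilon>, of "g z"] have "E_upper \<epsilon> (g z) = sgn (c * z) * (\<epsilon> / 2)"
      by metis
    then show ?case by (simp only:)
  qed
  then obtain d where d: "d > 0" "\<And>z. z \<noteq> 0 \<Longrightarrow> \<bar>z\<bar> < d \<Longrightarrow> ?f z = sgn (c * z) * (\<epsilon> / 2) / z\<^sup>2"
    unfolding eventually_at by (auto simp: dist_real_def)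
  define r where "r = min d R / 2"
  have r: "0 < r" "r < R" "r < d" using d(1) R by (auto simp: r_def)
  have "(LINT z:ball 0 \<rho> - ball 0 s|lborel. ?f z) = (LINT z:ball 0 \<rho> - ball 0 r|lborel. ?f z)"
    if s: "0 < s" "s < r" for s
  proof -
    let ?A = "ball 0 \<rho> \<inter> (ball 0 r - ball 0 s) :: real set"
    have int: "set_integrable lborel (ball 0 \<rho> - ball 0 s) ?f"
      using s by (intro set_integrable_annulus \<epsilon> g)
    have "ball 0 \<rho> - ball 0 s = (ball 0 \<rho> - ball 0 r) \<union> ?A"
      using s by auto
    then have "(LINT z:ball 0 \<rho> - ball 0 s|lborel. ?f z) =
        (LINT z:ball 0 \<rho> - ball 0 r|lborel. ?f z) + (LINT z:?A|lborel. ?f z)"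
      using s by (simp only:, intro set_integral_Un set_integrable_subset[OF int]) auto
    moreover have "(LINT z:?A|lborel. ?f z) = 0"
    proof -
      let ?h = "\<lambda>z. indicator ?A z * (sgn (c * z) * (\<epsilon> / 2) / z\<^sup>2) :: real"
      have "(LINT z:?A|lborel. ?f z) = (LINT z|lborel. ?h z)"
        unfolding set_lebesgue_integral_def
        using s r d(2) by (intro Bochner_Integration.integral_cong) (auto simp: indicator_def)
      moreover have "(LINT z|lborel. ?h z) = (LINT z|lborel. ?h (- z))"
        using lborel_integral_real_affine[of "-1" ?h 0] by simp
      moreover have "(LINT z|lborel. ?h (- z)) = (LINT z|lborel. - ?h z)"
        by (intro Bochner_Integration.integral_cong) (auto simp: indicator_def sgn_minus)
      ultimately show ?thesis by simp
    qed
    ultimately show ?thesis by simp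
  qed
  then have "\<forall>\<^sub>F s in at_right 0. (LINT z:ball 0 \<rho> - ball 0 s|lborel. ?f z) = (LINT z:ball 0 \<rho> - ball 0 r|lborel. ?f z)"
    using r(1) unfolding eventually_at_right_field by blast
  then have "((\<lambda>s. LINT z:ball 0 \<rho> - ball 0 s|lborel. ?f z) \<longlongrightarrow>
      (LINT z:ball 0 \<rho> - ball 0 r|lborel. ?f z)) (at_right 0)"
    by (rule tendsto_eventually)
  then show ?thesis using that r by blast
qed

section \<open>Derivatives and slices of test functions\<close>

lemma C2_on_partials:
  assumes "C2_on D \<phi>" and "p \<in> D"
  obtains \<phi>' where "(\<phi> has_derivative \<phi>') (at p)" "\<phi>' (1, 0) = dt \<phi> p" "\<phi>' (0, 1) = dx \<phi> p"
    "((\<lambda>s. \<phi> (s, snd p)) has_real_derivative dt \<phi> p) (at (fst p))"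
    "((\<lambda>z. \<phi> (fst p, z)) has_real_derivative dx \<phi> p) (at (snd p))"
proof -
  obtain t z where p: "p = (t, z)" by (cases p)
  obtain \<phi>' where der: "(\<phi> has_derivative \<phi>') (at (t, z))"
    using assms unfolding C2_on_def p by blast
  then have lin: "linear \<phi>'"
    by (rule has_derivative_linear)
  have "((\<lambda>s. (s, z)) has_derivative (\<lambda>h. (h, 0))) (at t)"
    by (auto intro!: derivative_eq_intros)
  then have "((\<lambda>s. \<phi> (s, z)) has_derivative (\<lambda>h. \<phi>' (h, 0))) (at t)"
    using has_derivative_compose[of "\<lambda>s. (s, z)" _ t UNIV \<phi> \<phi>'] der by simp
  moreover have "(\<lambda>h. \<phi>' (h, 0)) = (*) (\<phi>' (1, 0))"
  proof
    show "\<phi>' (h, 0) = \<phi>' (1, 0) * h" for h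
      using linear_scale[OF lin, of h "(1, 0)"] by (simp add: mult.commute)
  qed
  ultimately have t: "((\<lambda>s. \<phi> (s, z)) has_real_derivative \<phi>' (1, 0)) (at t)"
    by (simp only: has_field_derivative_def)
  have "((\<lambda>s. (t, s)) has_derivative (\<lambda>h. (0, h))) (at z)"
    by (auto intro!: derivative_eq_intros)
  then have "((\<lambda>s. \<phi> (t, s)) has_derivative (\<lambda>h. \<phi>' (0, h))) (at z)"
    using has_derivative_compose[of "\<lambda>s. (t, s)" _ z UNIV \<phi> \<phi>'] der by simp
  moreover have "(\<lambda>h. \<phi>' (0, h)) = (*) (\<phi>' (0, 1))"
  proof
    show "\<phi>' (0, h) = \<phi>' (0, 1) * h" for h
      using linear_scale[OF lin, of h "(0, 1)"] by (simp add: mult.commute)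
  qed
  ultimately have z: "((\<lambda>s. \<phi> (t, s)) has_real_derivative \<phi>' (0, 1)) (at z)"
    by (simp only: has_field_derivative_def)
  show ?thesis
    using that[of \<phi>'] der t z DERIV_imp_deriv[OF t] DERIV_imp_deriv[OF z] by (simp add: p dt_def dx_def)
qed

lemma slice_continuous:
  assumes "C2_on Q \<phi>" and "t > 0"
  shows "continuous_on UNIV (\<lambda>z. \<phi> (t, y + z))"
proof -
  have "isCont \<phi> (t, z)" for z
    using C2_on_partials[OF assms(1), of "(t, z)"] assms(2) has_derivative_continuous
    by (metis Q_def SigmaI UNIV_I greaterThan_iff)
  moreover have "isCont (\<lambda>z. (t, y + z)) w" for w
    by (intro continuous_intros)
  ultimately have "isCont (\<lambda>z. \<phi> (t, y + z)) w" for w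
    by (rule isCont_o2[rotated])
  then show ?thesis
    by (simp add: continuous_on_eq_continuous_at)
qed

subsection \<open>The subsolution property\<close>

context pre_collision
begin

section \<open>The nonlocal term at a fixed time\<close>

text \<open>Each particle away from \<open>y\<close> enters through its deviation from its
  contribution at \<open>z = 0\<close>. These deviations vanish near \<open>z = 0\<close> and can be
  integrated against \<open>1 / z\<^sup>2\<close> one by one.\<close>

lemma u_split:
  "u (\<tau>, y + z) = (1 / real n) * (of_int (left_sum y) +
    (\<Sum>j | j \<in> {1..n} \<and> x \<tau> j \<noteq> y.
      of_int (\<beta> j) * (heaviside (z - (x \<tau> j - y)) - (if x \<tau> j < y then 1 else 0))) +
    of_int (net y) * heaviside z)"
proof -
  let ?X = "{j. j \<in> {1..n} \<and> x \<tau> j \<noteq> y}"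
  let ?h = "\<lambda>j. of_int (\<beta> j) * heaviside (y + z - x \<tau> j) :: real"
  have "(\<Sum>j=1..n. ?h j) = (\<Sum>j\<in>?X \<union> colliding y. ?h j)"
    by (intro sum.mono_neutral_right) (auto simp: colliding_def)
  also have "\<dots> = (\<Sum>j\<in>?X. ?h j) + (\<Sum>j\<in>colliding y. ?h j)"
    by (intro sum.union_disjoint) (auto simp: colliding_def)
  also have "(\<Sum>j\<in>colliding y. ?h j) = of_int (net y) * heaviside z"
    using colliding(3) by (auto simp: net_def sum_distrib_right intro!: sum.cong)
  also have "(\<Sum>j\<in>?X. ?h j) = of_int (left_sum y) +
      (\<Sum>j\<in>?X. of_int (\<beta> j) * (heaviside (z - (x \<tau> j - y)) - (if x \<tau> j < y then 1 else 0)))"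
  proof -
    have "real_of_int (left_sum y) = (\<Sum>j\<in>{j \<in> ?X. x \<tau> j < y}. of_int (\<beta> j))"
      unfolding left_sum_def of_int_sum by (intro sum.cong) auto
    also have "\<dots> = (\<Sum>j\<in>?X. if x \<tau> j < y then of_int (\<beta> j) else 0)"
      by (intro sum.inter_filter) simp
    finally show ?thesis
      by (simp only: sum.distrib[symmetric], intro sum.cong) (auto simp: algebra_simps)
  qed
  finally show ?thesis by (simp add: u_at)
qed

lemma gap:
  obtains r where "r > 0" "\<And>j. j \<in> {1..n} \<Longrightarrow> x \<tau> j \<noteq> y \<Longrightarrow> r < \<bar>x \<tau> j - y\<bar>"
proof -
  \<comment> \<open>The \<open>1\<close> keeps the set nonempty when all particles are at
    \<open>y\<close>; halving the minimum makes the inequality strict.\<close>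
  let ?A = "insert 1 ((\<lambda>j. \<bar>x \<tau> j - y\<bar>) ` {j \<in> {1..n}. x \<tau> j \<noteq> y})"
  have pos: "Min ?A > 0" by (subst Min_gr_iff) auto
  have le: "Min ?A \<le> \<bar>x \<tau> j - y\<bar>" if "j \<in> {1..n}" "x \<tau> j \<noteq> y" for j
    using that by (intro Min_le) auto
  show ?thesis
  proof (rule that[of "Min ?A / 2"])
    show "Min ?A / 2 < \<bar>x \<tau> j - y\<bar>" if "j \<in> {1..n}" "x \<tau> j \<noteq> y" for j
      using le[OF that] pos by linarith
  qed (use pos in simp)
qed

lemma u_near:
  assumes "\<And>j. j \<in> {1..n} \<Longrightarrow> x \<tau> j \<noteq> y \<Longrightarrow> r < \<bar>x \<tau> j - y\<bar>" and "\<bar>z\<bar> < r"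
  shows "u (\<tau>, y + z) = (1 / real n) * (of_int (left_sum y) + of_int (net y) * heaviside z)"
proof -
  have "(\<Sum>j | j \<in> {1..n} \<and> x \<tau> j \<noteq> y.
      of_int (\<beta> j) * (heaviside (z - (x \<tau> j - y)) - (if x \<tau> j < y then 1 else 0))) = (0::real)"
    using assms by (intro sum.neutral) (force simp: heaviside_def)
  then show ?thesis by (simp add: u_split)
qed

text \<open>\<open>u\<close> and \<open>peak\<close> are integer multiples of \<open>1 / n\<close>,
  where the staircase function merely adds half a step. This makes the nonlocal term linear in the
  charges.\<close>

lemma E_upper_u:
  "E_upper (1 / real n) (u (\<tau>, z) - peak y) = u (\<tau>, z) - peak y + (1 / real n) * (1 / 2)"
proof -
  define k where "k = (\<Sum>j=1..n. \<beta> j * (if x \<tau> j \<le> z then 1 else 0)) - left_sum y - top_psum y"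
  have "(\<Sum>j=1..n. of_int (\<beta> j) * heaviside (z - x \<tau> j)) =
      real_of_int (\<Sum>j=1..n. \<beta> j * (if x \<tau> j \<le> z then 1 else 0))"
    by (auto simp: heaviside_def intro!: sum.cong)
  then have "u (\<tau>, z) - peak y = (1 / real n) * of_int k"
    by (simp add: u_at peak_def k_def algebra_simps)
  then show ?thesis
    using E_upper_multiple[of "1 / real n" k] n_pos by (simp add: algebra_simps)
qed

lemma u_measurable: "(\<lambda>z. u (\<tau>, y + z)) \<in> borel_measurable borel"
  unfolding u_at heaviside_def by measurable

text \<open>Under the condition on \<open>net y\<close>, the colliding group together with the half
  step contributes an odd function of \<open>z\<close>, whose integral is zero. The step of each
  other particle \<open>j\<close> integrates to \<open>- 1 / (y - x \<tau> j)\<close>.\<close>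

lemma nonlocal_integral:
  assumes net: "net y = 2 * top_psum y - 1" and r: "r > 0"
    and gap: "\<And>j. j \<in> {1..n} \<Longrightarrow> x \<tau> j \<noteq> y \<Longrightarrow> r < \<bar>x \<tau> j - y\<bar>"
  shows "(LINT z:- ball 0 r|lborel. E_upper (1 / real n) (u (\<tau>, y + z) - peak y) / z\<^sup>2) = - force y"
proof -
  let ?X = "{j. j \<in> {1..n} \<and> x \<tau> j \<noteq> y}"
  \<comment> \<open>\<open>?k j\<close> is the deviation caused by particle \<open>j\<close>,
    divided by \<open>z\<^sup>2\<close>; \<open>?s\<close> is the odd kernel, with integral
    \<open>1 / r - 1 / r\<close>.\<close>
  let ?k = "\<lambda>j z. if x \<tau> j < y then - (indicator {..<- (y - x \<tau> j)} z * (1 / z\<^sup>2))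
    else indicator {x \<tau> j - y..} z * (1 / z\<^sup>2) :: real"
  let ?s = "\<lambda>z. indicator {r..} z * (1 / z\<^sup>2) - indicator {..- r} z * (1 / z\<^sup>2) :: real"
  let ?c = "real_of_int (top_psum y) - 1 / 2"
  have "has_bochner_integral lborel (?k j) (- (1 / (y - x \<tau> j)))" if "j \<in> ?X" for j
  proof (cases "x \<tau> j < y")
    case True
    then show ?thesis
      using has_bochner_integral_minus[OF integral_inverse_square_left(2)[of "y - x \<tau> j"]] by simp
  next
    case False
    then have pos: "x \<tau> j - y > 0" using that by auto
    then have "1 / (x \<tau> j - y) = - (1 / (y - x \<tau> j))" by (simp add: divide_simps)
    then show ?thesis
      using integral_inverse_square_right[OF pos] False by (simp only: if_False)
  qed
  then have "has_bochner_integral lborel (\<lambda>z. (1 / real n) * ((\<Sum>j\<in>?X. of_int (\<beta> j) * ?k j z) + ?c * ?s z))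
      ((1 / real n) * ((\<Sum>j\<in>?X. of_int (\<beta> j) * (- (1 / (y - x \<tau> j)))) + ?c * (1 / r - 1 / r)))"
    by (intro has_bochner_integral_mult_right has_bochner_integral_add has_bochner_integral_sum
        has_bochner_integral_diff integral_inverse_square_left integral_inverse_square_right r)
  moreover have "(1 / real n) * ((\<Sum>j\<in>?X. of_int (\<beta> j) * (- (1 / (y - x \<tau> j)))) + ?c * (1 / r - 1 / r)) = - force y"
    by (simp add: force_def sum_negf)
  moreover have "(1 / real n) * ((\<Sum>j\<in>?X. of_int (\<beta> j) * ?k j z) + ?c * ?s z) =
      indicator (- ball 0 r) z *\<^sub>R (E_upper (1 / real n) (u (\<tau>, y + z) - peak y) / z\<^sup>2)" for z
  proof -
    let ?h = "\<lambda>j. heaviside (z - (x \<tau> j - y)) - (if x \<tau> j < y then 1 else 0)"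
    have "?k j z = indicator (- ball 0 r) z * (?h j * (1 / z\<^sup>2))" if "j \<in> ?X" for j
      using gap[of j] that r by (auto simp: indicator_def heaviside_def dist_real_def)
    then have "(\<Sum>j\<in>?X. of_int (\<beta> j) * ?k j z) =
        (\<Sum>j\<in>?X. of_int (\<beta> j) * ?h j) * (indicator (- ball 0 r) z * (1 / z\<^sup>2))"
      unfolding sum_distrib_right by (intro sum.cong) auto
    moreover have "?c * ?s z = (of_int (net y) * heaviside z - of_int (top_psum y) + 1 / 2) *
        (indicator (- ball 0 r) z * (1 / z\<^sup>2))"
      using r by (auto simp: net indicator_def heaviside_def dist_real_def algebra_simps)
    moreover have "E_upper (1 / real n) (u (\<tau>, y + z) - peak y) =
        (1 / real n) * ((\<Sum>j\<in>?X. of_int (\<beta> j) * ?h j) + (of_int (net y) * heaviside z - of_int (top_psum y) + 1 / 2))"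
      unfolding E_upper_u unfolding u_split peak_def by (simp add: algebra_simps)
    moreover have "a * (p * (i * (1 / w)) + q * (i * (1 / w))) = i *\<^sub>R (a * (p + q) / w)"
      for a p q i w :: real
      by (simp add: algebra_simps add_divide_distrib)
    ultimately show ?thesis
      by (simp only:)
  qed
  ultimately have "has_bochner_integral lborel
      (\<lambda>z. indicator (- ball 0 r) z *\<^sub>R (E_upper (1 / real n) (u (\<tau>, y + z) - peak y) / z\<^sup>2)) (- force y)"
    by (simp only:)
  then show ?thesis
    unfolding set_lebesgue_integral_def by (rule has_bochner_integral_integral_eq)
qed

end

text \<open>
  The following facts on the envelope need a bound on the function at all times, while the locale
  describes it only near \<open>\<tau>\<close>.
\<close>

locale bounded_pre_collision = pre_collision +
  assumes bound: "q \<in> Q \<Longrightarrow> \<bar>u q\<bar> \<le> 1"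
begin

abbreviation "v \<equiv> usc_env Q u"

lemma at_Q: "(\<tau>, z) \<in> Q"
  using \<delta> by (simp add: Q_def)

lemma u_le_v: "q \<in> Q \<Longrightarrow> u q \<le> v q"
  using bound by (rule usc_env_ge)

lemma v_le_peak: "v (\<tau>, z) \<le> peak z"
  using bound at_Q eventually_mono[OF u_le_peak] by (rule usc_env_le) auto

text \<open>With no particle at \<open>z\<close>, the upper bound \<open>peak z\<close> of the
  envelope coincides with \<open>u (\<tau>, z)\<close>.\<close>

lemma v_eq_u:
  assumes "z \<notin> x \<tau> ` {1..n}"
  shows "v (\<tau>, z) = u (\<tau>, z)"
proof -
  have 0: "colliding z = {}"
    using assms by (auto simp: colliding_def)
  then have "psum z k = 0" for k
    by (simp add: psum_def)
  then have top: "top_psum z = 0"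
    using top_attained by metis
  obtain r where r: "r > 0" "\<And>j. j \<in> {1..n} \<Longrightarrow> x \<tau> j \<noteq> z \<Longrightarrow> r < \<bar>x \<tau> j - z\<bar>"
    using gap by blast
  have "u (\<tau>, z) = peak z"
    using u_near[of z r 0] r top 0 by (simp add: peak_def net_def)
  then show ?thesis
    using v_le_peak[of z] u_le_v[OF at_Q, of z] by simp
qed

text \<open>Both integrands dominate the one of \<open>nonlocal_integral\<close>, because the
  staircase function is monotone: inside the ball since \<open>\<phi>\<close> touches
  \<open>v\<close> from above and \<open>u \<le> v\<close>, outside since
  \<open>v (\<tau>, y)\<close> is at most \<open>peak y\<close>.\<close>

lemma hamiltonian_ge:
  assumes net: "net y = 2 * top_psum y - 1" and \<rho>: "\<rho> > 0"
    and \<phi>: "C2_on Q \<phi>" and dx: "dx \<phi> (\<tau>, y) \<noteq> 0"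
    and touch: "\<And>q. q \<in> Q \<Longrightarrow> v q - \<phi> q \<le> v (\<tau>, y) - \<phi> (\<tau>, y)"
  shows "- \<bar>dx \<phi> (\<tau>, y)\<bar> * force y \<le> H_upper \<rho> (1 / real n) \<phi> v (\<tau>, y)"
proof -
  let ?\<epsilon> = "1 / real n"
  let ?e = "E_upper ?\<epsilon>"
  let ?W = "\<lambda>z. ?e (u (\<tau>, y + z) - peak y) / z\<^sup>2"
  let ?g = "\<lambda>z. \<phi> (\<tau>, y + z) - \<phi> (\<tau>, y)"
  have \<epsilon>: "?\<epsilon> > 0" using n_pos by simp
  have mono: "?e \<alpha> / z\<^sup>2 \<le> ?e \<alpha>' / z\<^sup>2" if "\<alpha> \<le> \<alpha>'" for \<alpha> \<alpha>' z
    using E_mono[OF \<epsilon> that] by (simp add: E_upper_def divide_right_mono)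
  obtain r0 where r0: "r0 > 0" "\<And>j. j \<in> {1..n} \<Longrightarrow> x \<tau> j \<noteq> y \<Longrightarrow> r0 < \<bar>x \<tau> j - y\<bar>"
    using gap by blast
  have cont: "continuous_on UNIV ?g"
    using slice_continuous[OF \<phi>, of \<tau>] \<delta> by (intro continuous_intros) auto
  obtain \<phi>' where "((\<lambda>z. \<phi> (\<tau>, z)) has_real_derivative dx \<phi> (\<tau>, y)) (at y)"
    using C2_on_partials[OF \<phi> at_Q] by (metis fst_conv snd_conv)
  then have "((\<lambda>z. \<phi> (\<tau>, y + z)) has_real_derivative dx \<phi> (\<tau>, y)) (at 0)"
    using DERIV_shift[of "\<lambda>z. \<phi> (\<tau>, z)" _ 0 y] by (simp add: add.commute)
  then have der: "(?g has_real_derivative dx \<phi> (\<tau>, y)) (at 0)"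
    by (auto intro!: derivative_eq_intros)
  \<comment> \<open>A radius below both the gap and \<open>\<rho>\<close> turns the principal value
    into an ordinary integral and excludes no other particle from the nonlocal one.\<close>
  obtain r where r: "0 < r" "r < min r0 \<rho>"
    and lim: "((\<lambda>s. LINT z:ball 0 \<rho> - ball 0 s|lborel. ?e (?g z) / z\<^sup>2) \<longlongrightarrow>
      (LINT z:ball 0 \<rho> - ball 0 r|lborel. ?e (?g z) / z\<^sup>2)) (at_right 0)"
    using pv_tendsto[OF \<epsilon> cont _ der dx, of "min r0 \<rho>"] r0(1) \<rho> by auto
  have "pv_integral \<rho> (\<lambda>z. ?e (?g z) / z\<^sup>2) = (LINT z:ball 0 \<rho> - ball 0 r|lborel. ?e (?g z) / z\<^sup>2)"
    unfolding pv_integral_def by (rule tendsto_Lim[OF trivial_limit_at_right_real lim])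
  have bd: "\<bar>u (\<tau>, z)\<bar> \<le> 1" for z
    using bound[OF at_Q] .
  have int_u: "set_integrable lborel (- ball 0 s) (\<lambda>z. ?e (u (\<tau>, y + z) - c) / z\<^sup>2)" if "s > 0" for s c
  proof (rule set_integrable_over_square[OF that])
    have "(\<lambda>z. u (\<tau>, y + z) - c) \<in> borel_measurable borel"
      using u_measurable by (intro borel_measurable_diff) auto
    then show "(\<lambda>z. ?e (u (\<tau>, y + z) - c)) \<in> borel_measurable borel"
      by (rule measurable_compose[OF _ E_upper_measurable[OF \<epsilon>]])
    show "\<bar>?e (u (\<tau>, y + z) - c)\<bar> \<le> ?\<epsilon> + 1 + \<bar>c\<bar>" for z
      using E_upper_near[OF \<epsilon>, of "u (\<tau>, y + z) - c"] bd[of "y + z"] by linarith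
  qed
  note int_W = int_u[of _ "peak y"]
  have inner: "(LINT z:ball 0 \<rho> - ball 0 r|lborel. ?W z) \<le> pv_integral \<rho> (\<lambda>z. ?e (?g z) / z\<^sup>2)"
    unfolding \<open>pv_integral \<rho> _ = _\<close>
  proof (rule set_integral_mono)
    show "set_integrable lborel (ball 0 \<rho> - ball 0 r) ?W"
      by (rule set_integrable_subset[OF int_W[OF r(1)]]) auto
    show "set_integrable lborel (ball 0 \<rho> - ball 0 r) (\<lambda>z. ?e (?g z) / z\<^sup>2)"
      using r by (intro set_integrable_annulus \<epsilon> cont)
    show "?W z \<le> ?e (?g z) / z\<^sup>2" for z
      using touch[OF at_Q, of "y + z"] u_le_v[OF at_Q, of "y + z"] v_le_peak[of y]
      by (intro mono) linarith
  qed
  have "(LINT z:- ball 0 \<rho>|lborel. ?W z) \<le> (LINT z:- ball 0 \<rho>|lborel. ?e (u (\<tau>, y + z) - v (\<tau>, y)) / z\<^sup>2)"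
    using v_le_peak[of y] \<rho> by (intro set_integral_mono int_u mono) auto
  \<comment> \<open>At time \<open>\<tau>\<close> the envelope differs from \<open>u\<close> at most
    at the particle positions, a null set.\<close>
  also have "\<dots> = (LINT z:- ball 0 \<rho>|lborel. ?e (v (\<tau>, y + z) - v (\<tau>, y)) / z\<^sup>2)"
    unfolding set_lebesgue_integral_def
  proof (rule integral_discrete_difference)
    show "countable ((\<lambda>j. x \<tau> j - y) ` {1..n})" by simp
    show "indicator (- ball 0 \<rho>) z *\<^sub>R (?e (u (\<tau>, y + z) - v (\<tau>, y)) / z\<^sup>2) =
        indicator (- ball 0 \<rho>) z *\<^sub>R (?e (v (\<tau>, y + z) - v (\<tau>, y)) / z\<^sup>2)"
      if "z \<notin> (\<lambda>j. x \<tau> j - y) ` {1..n}" for z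
    proof -
      have "y + z \<notin> x \<tau> ` {1..n}" using that by (force simp: image_iff)
      then show ?thesis by (simp add: v_eq_u)
    qed
  qed auto
  finally have outer: "(LINT z:- ball 0 \<rho>|lborel. ?W z) \<le>
      (LINT z:- ball 0 \<rho>|lborel. ?e (v (\<tau>, y + z) - v (\<tau>, y)) / z\<^sup>2)" .
  have "- ball 0 r = (ball 0 \<rho> - ball 0 r) \<union> (- ball 0 \<rho> :: real set)"
    using r by auto
  then have "(LINT z:- ball 0 r|lborel. ?W z) =
      (LINT z:ball 0 \<rho> - ball 0 r|lborel. ?W z) + (LINT z:- ball 0 \<rho>|lborel. ?W z)"
    by (simp only:, intro set_integral_Un set_integrable_subset[OF int_W[OF r(1)]]) (use r in auto)
  moreover have "(LINT z:- ball 0 r|lborel. ?W z) = - force y"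
    using r r0(2) by (intro nonlocal_integral[OF net]) force+
  ultimately have "- force y \<le> pv_integral \<rho> (\<lambda>z. ?e (?g z) / z\<^sup>2) +
      (LINT z:- ball 0 \<rho>|lborel. ?e (v (\<tau>, y + z) - v (\<tau>, y)) / z\<^sup>2)"
    using inner outer by linarith
  from mult_left_mono[OF this abs_ge_zero[of "dx \<phi> (\<tau>, y)"]]
  show ?thesis
    by (simp add: H_upper_def hamiltonian_def)
qed

text \<open>The sign of the \<open>x\<close>-derivative selects the extremal particle, whose charge
  has that sign. Its two adjacent partial sums are \<open>top_psum y\<close> and
  \<open>top_psum y - 1\<close>, so comparing their sum with \<open>net y\<close> decides whether
  the pull blows up.\<close>

lemma extremal_speed:
  assumes \<phi>: "C2_on Q \<phi>" and dx: "dx \<phi> (\<tau>, y) \<noteq> 0"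
    and touch: "\<And>q. q \<in> Q \<Longrightarrow> v q - \<phi> q \<le> v (\<tau>, y) - \<phi> (\<tau>, y)"
    and L: "L < force y \<or> net y < 2 * top_psum y - 1"
  shows "net y \<le> 2 * top_psum y - 1" "dt \<phi> (\<tau>, y) \<le> - \<bar>dx \<phi> (\<tau>, y)\<bar> * L"
proof -
  define c where "c = v (\<tau>, y) - \<phi> (\<tau>, y)"
  have le: "u q \<le> \<phi> q + c" if "q \<in> Q" for q
    using touch[OF that] u_le_v[OF that] by (simp add: c_def)
  have peak: "\<phi> (\<tau>, y) + c \<le> peak y"
    using v_le_peak[of y] by (simp add: c_def)
  have cont: "isCont \<phi> q" if "q \<in> Q" for q
    using C2_on_partials[OF \<phi> that] has_derivative_continuous by metis
  obtain \<phi>' where der: "(\<phi> has_derivative \<phi>') (at (\<tau>, y))" "\<phi>' (1, 0) = dt \<phi> (\<tau>, y)"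
    "\<phi>' (0, 1) = dx \<phi> (\<tau>, y)"
    and der_x: "((\<lambda>z. \<phi> (\<tau>, z)) has_real_derivative dx \<phi> (\<tau>, y)) (at y)"
    using C2_on_partials[OF \<phi> at_Q] by (metis fst_conv snd_conv)
  obtain r where r: "r > 0" "\<And>j. j \<in> {1..n} \<Longrightarrow> x \<tau> j \<noteq> y \<Longrightarrow> r < \<bar>x \<tau> j - y\<bar>"
    using gap by blast
  note near = u_near[of y r, OF r(2)]
  obtain i where i: "i \<in> colliding y" and sgn: "of_int (\<beta> i) = sgn (dx \<phi> (\<tau>, y))"
    and top: "psum y i = top_psum y \<or> psum y (Suc i) = top_psum y"
    and sum: "psum y i + psum y (Suc i) = 2 * top_psum y - 1"
    and left: "\<And>k. k < i \<Longrightarrow> psum y k \<le> psum y i"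
    and right: "\<And>k. i < k \<Longrightarrow> psum y k \<le> psum y (Suc i)"
    and net: "net y \<le> 2 * top_psum y - 1"
  proof (cases "dx \<phi> (\<tau>, y) > 0")
    case True
    obtain d where d: "d > 0" "\<And>h. 0 < h \<Longrightarrow> h < d \<Longrightarrow> \<phi> (\<tau>, y - h) < \<phi> (\<tau>, y)"
      using DERIV_pos_inc_left[OF der_x True] by blast
    \<comment> \<open>Otherwise \<open>u\<close> equals \<open>peak y\<close> just to the left of
      \<open>y\<close>, where \<open>\<phi> + c\<close> is already smaller.\<close>
    have "0 < top_psum y"
    proof (rule ccontr)
      assume "\<not> 0 < top_psum y"
      then have "top_psum y = 0" using top_bounds(1)[of y] by simp
      moreover define h where "h = min d r / 2"
      have h: "0 < h" "h < d" "h < r" using d(1) r(1) by (auto simp: h_def)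
      ultimately have "u (\<tau>, y - h) = peak y"
        using near[of "- h"] by (simp add: peak_def heaviside_def)
      then show False
        using d(2)[OF h(1,2)] le[OF at_Q, of "y - h"] peak by simp
    qed
    then obtain i where "i \<in> colliding y" "\<beta> i = 1" "psum y (Suc i) = top_psum y"
      "\<And>k. k \<le> i \<Longrightarrow> psum y k < top_psum y"
      using leftmost_peak by blast
    moreover from this have "psum y i = top_psum y - 1"
      by (simp add: psum_Suc)
    \<comment> \<open>The bound on \<open>net y\<close> follows from
      \<open>net y \<le> top_psum y\<close> and \<open>1 \<le> top_psum y\<close>.\<close>
    ultimately show ?thesis
      using that[of i] True psum_le_top[of y] top_bounds[of y] \<open>0 < top_psum y\<close> by fastforce
  next
    case False
    then have neg: "dx \<phi> (\<tau>, y) < 0" using dx by simp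
    obtain d where d: "d > 0" "\<And>h. 0 < h \<Longrightarrow> h < d \<Longrightarrow> \<phi> (\<tau>, y + h) < \<phi> (\<tau>, y)"
      using DERIV_neg_dec_right[OF der_x neg] by blast
    \<comment> \<open>Mirror image: the value just to the right of \<open>y\<close> is determined by
      \<open>left_sum y + net y\<close>.\<close>
    have "net y < top_psum y"
    proof (rule ccontr)
      assume "\<not> net y < top_psum y"
      then have "top_psum y = net y" using top_bounds(2)[of y] by simp
      moreover define h where "h = min d r / 2"
      have h: "0 < h" "h < d" "h < r" using d(1) r(1) by (auto simp: h_def)
      ultimately have "u (\<tau>, y + h) = peak y"
        using near[of h] by (simp add: peak_def heaviside_def)
      then show False
        using d(2)[OF h(1,2)] le[OF at_Q, of "y + h"] peak by simp
    qed
    then obtain i where "i \<in> colliding y" "\<beta> i = -1" "psum y i = top_psum y"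
      "\<And>k. i < k \<Longrightarrow> psum y k < top_psum y"
      using rightmost_peak by blast
    moreover from this have "psum y (Suc i) = top_psum y - 1"
      by (simp add: psum_Suc)
    \<comment> \<open>Here the bound on \<open>net y\<close> follows from
      \<open>net y \<le> top_psum y - 1\<close> and \<open>0 \<le> top_psum y\<close>.\<close>
    ultimately show ?thesis
      using that[of i] neg psum_le_top[of y] top_bounds[of y] \<open>net y < top_psum y\<close> by fastforce
  qed
  show "net y \<le> 2 * top_psum y - 1" by (rule net)
  have "\<forall>\<^sub>F t in at_left \<tau>. peak y \<le> \<phi> (t, x t i) + c"
    by (rule touching_peak[OF i top le cont])
  then have "\<forall>\<^sub>F t in at_left \<tau>. \<phi> (\<tau>, y) \<le> \<phi> (t, x t i)"
    by eventually_elim (use peak in linarith)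
  moreover have "\<forall>\<^sub>F t in at_left \<tau>. L * (\<tau> - t) \<le> sgn (\<phi>' (0, 1)) * (y - x t i)"
    using speed[OF i left right, of L] net sum L by (simp add: der sgn)
  moreover have "((\<lambda>t. x t i) \<longlongrightarrow> y) (at_left \<tau>)"
    using position_tendsto[of i] colliding(2,3)[OF i] by simp
  ultimately have "\<phi>' (1, 0) \<le> - \<bar>\<phi>' (0, 1)\<bar> * L"
    using dx by (intro touching_path[OF der(1)]) (auto simp: der)
  then show "dt \<phi> (\<tau>, y) \<le> - \<bar>dx \<phi> (\<tau>, y)\<bar> * L" by (simp add: der)
qed

lemma subsolution_test:
  assumes \<phi>: "C2_on Q \<phi>" and dx: "dx \<phi> (\<tau>, y) \<noteq> 0" and \<rho>: "\<rho> > 0"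
    and touch: "\<And>q. q \<in> Q \<Longrightarrow> v q - \<phi> q \<le> v (\<tau>, y) - \<phi> (\<tau>, y)"
  shows "dt \<phi> (\<tau>, y) \<le> H_upper \<rho> (1 / real n) \<phi> v (\<tau>, y)"
proof -
  note speed = extremal_speed[OF \<phi> dx touch]
  let ?c = "\<bar>dx \<phi> (\<tau>, y)\<bar>"
  have c: "?c > 0" using dx by simp
  have "\<not> net y < 2 * top_psum y - 1"
  proof
    assume "net y < 2 * top_psum y - 1"
    \<comment> \<open>This speed is chosen such that the right side equals
      \<open>dt \<phi> (\<tau>, y) - 1\<close>.\<close>
    then have "dt \<phi> (\<tau>, y) \<le> - ?c * ((1 - dt \<phi> (\<tau>, y)) / ?c)"
      by (intro speed(2)) auto
    then show False using c by simp
  qed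
  then have net: "net y = 2 * top_psum y - 1"
    using speed(1)[of "force y - 1"] by simp
  \<comment> \<open>In the remaining case every \<open>L\<close> below \<open>force y\<close> is
    admissible; let \<open>L\<close> increase to \<open>force y\<close>.\<close>
  have "((\<lambda>L. - ?c * L) \<longlongrightarrow> - ?c * force y) (at_left (force y))"
    by (intro tendsto_intros)
  moreover have "\<forall>\<^sub>F L in at_left (force y). dt \<phi> (\<tau>, y) \<le> - ?c * L"
    using speed(2) by (auto simp: eventually_at_filter intro!: always_eventually)
  ultimately have "dt \<phi> (\<tau>, y) \<le> - ?c * force y"
    using tendsto_lowerbound trivial_limit_at_left_real by blast
  also have "\<dots> \<le> H_upper \<rho> (1 / real n) \<phi> v (\<tau>, y)"
    using net \<rho> \<phi> dx touch by (rule hamiltonian_ge)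
  finally show ?thesis .
qed

text \<open>The \<open>x\<close>-derivative vanishes at \<open>y\<close>, so the direction of motion
  gives no information. Instead the square-root rate of approach makes the quartic term quadratic in
  \<open>\<tau> - t\<close>.\<close>

lemma subsolution_quartic:
  assumes \<phi>: "C2_on Q \<phi>" and quartic: "quartic_at y \<phi>"
    and touch: "\<And>q. q \<in> Q \<Longrightarrow> v q - \<phi> q \<le> v (\<tau>, y) - \<phi> (\<tau>, y)"
  shows "dt \<phi> (\<tau>, y) \<le> 0"
proof -
  define c where "c = v (\<tau>, y) - \<phi> (\<tau>, y)"
  have le: "u q \<le> \<phi> q + c" if "q \<in> Q" for q
    using touch[OF that] u_le_v[OF that] by (simp add: c_def)
  have peak: "\<phi> (\<tau>, y) + c \<le> peak y"
    using v_le_peak[of y] by (simp add: c_def)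
  have cont: "isCont \<phi> q" if "q \<in> Q" for q
    using C2_on_partials[OF \<phi> that] has_derivative_continuous by metis
  obtain a g where ag: "\<And>t z. (t, z) \<in> Q \<Longrightarrow> \<phi> (t, z) = a * \<bar>z - y\<bar> ^ 4 + g t"
    using quartic unfolding quartic_at_def by blast
  have der: "((\<lambda>s. \<phi> (s, y)) has_real_derivative dt \<phi> (\<tau>, y)) (at \<tau>)"
    using C2_on_partials[OF \<phi> at_Q] by (metis fst_conv snd_conv)
  have "\<exists>K. \<forall>\<^sub>F t in at_left \<tau>. \<phi> (\<tau>, y) - K * (\<tau> - t)\<^sup>2 \<le> \<phi> (t, y)"
  proof (cases "colliding y = {}")
    case True
    have "\<forall>\<^sub>F t in at_left \<tau>. peak y \<le> \<phi> (t, y) + c"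
      using True le by (rule touching_alone)
    then have "\<forall>\<^sub>F t in at_left \<tau>. \<phi> (\<tau>, y) - 0 * (\<tau> - t)\<^sup>2 \<le> \<phi> (t, y)"
      by eventually_elim (use peak in simp)
    then show ?thesis ..
  next
    case False
    obtain i where i: "i \<in> colliding y" "psum y i = top_psum y \<or> psum y (Suc i) = top_psum y"
      using some_peak[OF False] .
    have "\<forall>\<^sub>F t in at_left \<tau>. peak y \<le> \<phi> (t, x t i) + c"
      by (rule touching_peak[OF i le cont])
    then have "\<forall>\<^sub>F t in at_left \<tau>. \<phi> (\<tau>, y) - \<bar>a\<bar> * (real (n + 1))\<^sup>2 * (\<tau> - t)\<^sup>2 \<le> \<phi> (t, y)"
      using colliding_rate[OF i(1)] near_before
    proof eventually_elim
      case (elim t)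
      then have Q: "(t, z) \<in> Q" for z
        using \<delta> by (simp add: Q_def)
      have "\<phi> (t, y) = \<phi> (t, x t i) - a * \<bar>x t i - y\<bar> ^ 4"
        using ag[OF Q] by simp
      moreover have "\<bar>x t i - y\<bar> ^ 4 = ((x t i - y)\<^sup>2)\<^sup>2"
        by (simp add: power4_eq_xxxx power2_eq_square)
      moreover have "((x t i - y)\<^sup>2)\<^sup>2 \<le> (real (n + 1) * (\<tau> - t))\<^sup>2"
        using elim(2) by (intro power_mono) auto
      then have "\<bar>a\<bar> * ((x t i - y)\<^sup>2)\<^sup>2 \<le> \<bar>a\<bar> * (real (n + 1) * (\<tau> - t))\<^sup>2"
        by (intro mult_left_mono) auto
      moreover have "a * ((x t i - y)\<^sup>2)\<^sup>2 \<le> \<bar>a\<bar> * ((x t i - y)\<^sup>2)\<^sup>2"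
        by (intro mult_right_mono) auto
      ultimately show ?case
        using elim(1) peak by (simp only: power_mult_distrib mult.assoc)
    qed
    then show ?thesis ..
  qed
  then show ?thesis
    using deriv_nonpos_of_past[OF der] by blast
qed

end

text \<open>The local description at each positive time bounds \<open>u\<close> at that time, which
  together yields the global bound; each touching point is then treated at its own time.\<close>

lemma subsolution_of_pre_collision:
  assumes approach: "\<And>\<tau>. \<tau> > 0 \<Longrightarrow> \<exists>\<beta> \<delta>. pre_collision n x b \<beta> \<tau> \<delta>" and \<rho>: "\<rho> > 0"
  shows "subsolution \<rho> (1 / real n) (usc_env Q (u_n n x b))"
proof -
  have bound: "\<bar>u_n n x b q\<bar> \<le> 1" if "q \<in> Q" for q
    using approach[of "fst q"] that pre_collision.u_bound[of n x b _ "fst q" _ "snd q"]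
    by (auto simp: Q_def)
  have loc: "\<exists>\<beta> \<delta>. bounded_pre_collision n x b \<beta> (fst p) \<delta>" if "p \<in> Q" for p
    using approach[of "fst p"] that bound
    by (auto simp: Q_def bounded_pre_collision_def bounded_pre_collision_axioms_def)
  show ?thesis
    unfolding subsolution_def
  proof (intro conjI allI ballI impI)
    show "bounded (usc_env Q (u_n n x b) ` Q)"
      using bound by (rule bounded_usc_env)
    show "usc_on Q (usc_env Q (u_n n x b))"
      using bound by (rule usc_on_usc_env)
    fix \<phi> p
    assume p: "p \<in> Q" and touch: "C2_on Q \<phi> \<and> (\<forall>q\<in>Q. usc_env Q (u_n n x b) q - \<phi> q \<le> usc_env Q (u_n n x b) p - \<phi> p)"
    obtain \<beta> \<delta> where "bounded_pre_collision n x b \<beta> (fst p) \<delta>"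
      using loc[OF p] by blast
    then interpret bounded_pre_collision n x b \<beta> "fst p" \<delta> .
    show "dt \<phi> p \<le> H_upper \<rho> (1 / real n) \<phi> (usc_env Q (u_n n x b)) p" if "dx \<phi> p \<noteq> 0"
      using subsolution_test[of \<phi> "snd p" \<rho>] touch that \<rho> by simp
    show "dt \<phi> p \<le> 0" if "quartic_at (snd p) \<phi>"
      using subsolution_quartic[of \<phi> "snd p"] touch that by simp
  qed
qed

section \<open>Negation and the supersolution property\<close>

lemma C2_on_minus:
  assumes "C2_on D \<phi>"
  shows "C2_on D (\<lambda>q. - \<phi> q)"
proof -
  obtain \<phi>' :: "real \<times> real \<Rightarrow> (real \<times> real) \<Rightarrow>\<^sub>L real"
    and \<phi>'' :: "real \<times> real \<Rightarrow> (real \<times> real) \<Rightarrow>\<^sub>L (real \<times> real) \<Rightarrow>\<^sub>L real"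
    where *: "\<forall>p\<in>D. (\<phi> has_derivative blinfun_apply (\<phi>' p)) (at p)"
      "\<forall>p\<in>D. (\<phi>' has_derivative blinfun_apply (\<phi>'' p)) (at p)" "continuous_on D \<phi>''"
    using assms unfolding C2_on_def by blast
  have "((\<lambda>q. - \<phi> q) has_derivative blinfun_apply (- \<phi>' p)) (at p)"
    "((\<lambda>q. - \<phi>' q) has_derivative blinfun_apply (- \<phi>'' p)) (at p)" if "p \<in> D" for p
    using * that by (auto intro!: derivative_eq_intros simp: uminus_blinfun.rep_eq)
  moreover have "continuous_on D (\<lambda>p. - \<phi>'' p)"
    using *(3) by (rule continuous_on_minus)
  ultimately show ?thesis
    unfolding C2_on_def by (intro exI[of _ "\<lambda>p. - \<phi>' p"] exI[of _ "\<lambda>p. - \<phi>'' p"]) auto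
qed

lemma partials_minus:
  assumes "C2_on D \<phi>" and "p \<in> D"
  shows "dt (\<lambda>q. - \<phi> q) p = - dt \<phi> p" and "dx (\<lambda>q. - \<phi> q) p = - dx \<phi> p"
proof -
  obtain \<phi>' where "(\<phi> has_derivative \<phi>') (at p)"
    and t: "((\<lambda>s. \<phi> (s, snd p)) has_real_derivative dt \<phi> p) (at (fst p))"
    and z: "((\<lambda>z. \<phi> (fst p, z)) has_real_derivative dx \<phi> p) (at (snd p))"
    using C2_on_partials[OF assms] by metis
  show "dt (\<lambda>q. - \<phi> q) p = - dt \<phi> p" "dx (\<lambda>q. - \<phi> q) p = - dx \<phi> p"
    using DERIV_imp_deriv[OF DERIV_minus[OF t]] DERIV_imp_deriv[OF DERIV_minus[OF z]]
    by (simp_all add: dt_def dx_def split_beta)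
qed

text \<open>\<open>Lim\<close> commutes with negation when the limit exists. Regularity and the
  nonzero slope provide this for the principal value.\<close>

lemma H_lower_minus:
  assumes \<epsilon>: "\<epsilon> > 0" and \<psi>: "C2_on Q \<psi>" and p: "p \<in> Q" and dx: "dx \<psi> p \<noteq> 0"
  shows "H_lower \<rho> \<epsilon> \<psi> w p = - H_upper \<rho> \<epsilon> (\<lambda>q. - \<psi> q) (\<lambda>q. - w q) p"
proof -
  obtain t y where ty: "p = (t, y)" by (cases p)
  define g where "g z = - \<psi> (t, y + z) + \<psi> (t, y)" for z
  have t: "t > 0" using p by (simp add: ty Q_def)
  have cont: "continuous_on UNIV g"
    unfolding g_def using slice_continuous[OF \<psi> t, of y] by (intro continuous_intros)
  have "((\<lambda>z. \<psi> (t, z)) has_real_derivative dx \<psi> p) (at y)"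
    using C2_on_partials[OF \<psi> p] by (metis fst_conv snd_conv ty)
  then have "((\<lambda>z. \<psi> (t, y + z)) has_real_derivative dx \<psi> p) (at 0)"
    using DERIV_shift[of "\<lambda>z. \<psi> (t, z)" _ 0 y] by (simp add: add.commute)
  then have der: "(g has_real_derivative - dx \<psi> p) (at 0)"
    unfolding g_def by (auto intro!: derivative_eq_intros)
  define e where "e z = E_upper \<epsilon> (g z) / z\<^sup>2" for z
  obtain L where lim: "((\<lambda>s. LINT z:ball 0 \<rho> - ball 0 s|lborel. e z) \<longlongrightarrow> L) (at_right 0)"
    using pv_tendsto[OF \<epsilon> cont _ der, of 1 \<rho> thesis] dx by (auto simp: g_def e_def)
  have neg: "(LINT z:A|lborel. - f z) = - (LINT z:A|lborel. f z)" for A and f :: "real \<Rightarrow> real"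
    by (simp add: set_lebesgue_integral_def)
  have "((\<lambda>s. LINT z:ball 0 \<rho> - ball 0 s|lborel. - e z) \<longlongrightarrow> - L) (at_right 0)"
    unfolding neg by (intro tendsto_minus lim)
  then have "pv_integral \<rho> (\<lambda>z. - e z) = - pv_integral \<rho> e"
    using lim by (simp add: pv_integral_def tendsto_Lim[OF trivial_limit_at_right_real])
  then have "pv_integral \<rho> (\<lambda>z. E_lower \<epsilon> (\<psi> (t, y + z) - \<psi> (t, y)) / z\<^sup>2) =
      - pv_integral \<rho> (\<lambda>z. E_upper \<epsilon> (- \<psi> (t, y + z) - - \<psi> (t, y)) / z\<^sup>2)"
    by (simp add: e_def[abs_def] g_def E_lower_eq)
  moreover have "(LINT z:- ball 0 \<rho>|lborel. E_lower \<epsilon> (w (t, y + z) - w (t, y)) / z\<^sup>2) =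
      - (LINT z:- ball 0 \<rho>|lborel. E_upper \<epsilon> (- w (t, y + z) - - w (t, y)) / z\<^sup>2)"
    unfolding neg[symmetric] by (simp add: E_lower_eq)
  ultimately show ?thesis
    using partials_minus(2)[OF \<psi> p] by (simp add: H_lower_def H_upper_def hamiltonian_def ty algebra_simps)
qed

lemma supersolution_minus:
  assumes \<epsilon>: "\<epsilon> > 0" and sub: "subsolution \<rho> \<epsilon> (\<lambda>q. - w q)"
  shows "supersolution \<rho> \<epsilon> w"
  unfolding supersolution_def
proof (intro conjI allI ballI impI)
  have "bounded ((\<lambda>q. - w q) ` Q)"
    using sub by (simp add: subsolution_def)
  then show "bounded (w ` Q)"
    by (simp add: bounded_iff)
  show "lsc_on Q w"
    unfolding lsc_on_def
  proof (intro ballI allI impI)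
    fix p a assume "p \<in> Q" "a < w p"
    then have "\<forall>\<^sub>F q in at p within Q. - w q < - a"
      using sub unfolding subsolution_def usc_on_def by (metis neg_less_iff_less)
    then show "\<forall>\<^sub>F q in at p within Q. w q > a"
      by simp
  qed
  fix \<psi> p assume p: "p \<in> Q" and touch: "C2_on Q \<psi> \<and> (\<forall>q\<in>Q. w q - \<psi> q \<ge> w p - \<psi> p)"
  then have \<psi>: "C2_on Q \<psi>" by blast
  have *: "(dx (\<lambda>q. - \<psi> q) p \<noteq> 0 \<longrightarrow> dt (\<lambda>q. - \<psi> q) p \<le> H_upper \<rho> \<epsilon> (\<lambda>q. - \<psi> q) (\<lambda>q. - w q) p) \<and>
      (quartic_at (snd p) (\<lambda>q. - \<psi> q) \<longrightarrow> dt (\<lambda>q. - \<psi> q) p \<le> 0)"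
    using sub p C2_on_minus[OF \<psi>] touch unfolding subsolution_def by fastforce
  show "dt \<psi> p \<ge> H_lower \<rho> \<epsilon> \<psi> w p" if "dx \<psi> p \<noteq> 0"
    using * that by (simp add: partials_minus[OF \<psi> p] H_lower_minus[OF \<epsilon> \<psi> p])
  show "dt \<psi> p \<ge> 0" if quartic: "quartic_at (snd p) \<psi>"
  proof -
    obtain c g where "\<forall>(t, x)\<in>Q. \<psi> (t, x) = c * \<bar>x - snd p\<bar> ^ 4 + g t"
      using quartic unfolding quartic_at_def by blast
    then have "quartic_at (snd p) (\<lambda>q. - \<psi> q)"
      unfolding quartic_at_def by (intro exI[of _ "- c"] exI[of _ "\<lambda>t. - g t"]) auto
    then show ?thesis
      using * by (simp add: partials_minus[OF \<psi> p])
  qed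
qed

text \<open>Motion and ordering involve only products of two charges, and conservation is linear in
  them.\<close>

lemma pre_collision_minus:
  assumes "pre_collision n x b \<beta> \<tau> \<delta>"
  shows "pre_collision n x (\<lambda>t j. - b t j) (\<lambda>j. - \<beta> j) \<tau> \<delta>"
proof -
  interpret pre_collision n x b \<beta> \<tau> \<delta> by fact
  show ?thesis
  proof
    show "(x \<tau>, \<lambda>j. - b \<tau> j) \<in> configs n"
      using config by (auto simp: configs_def)
    show "- \<beta> j \<in> {- 1, 0, 1}" if "j \<in> {1..n}" for j
      using charge[OF that] by auto
    show "(\<Sum>j | j \<in> {1..n} \<and> x \<tau> j = y. - b \<tau> j) = (\<Sum>j | j \<in> {1..n} \<and> x \<tau> j = y. real_of_int (- \<beta> j))" for y
      using conserved[of y] by (simp only: of_int_minus sum_negf)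
    show "- b t j = of_int (- \<beta> j)" if "t \<in> {\<tau> - \<delta><..<\<tau>}" "j \<in> {1..n}" for t j
      using before[OF that] by simp
    show "- b t j = - b \<tau> j" if "t \<in> {\<tau>..<\<tau> + \<delta>}" "j \<in> {1..n}" for t j
      using after[OF that] by simp
    show "x t i < x t j"
      if "t \<in> {\<tau> - \<delta><..<\<tau>}" "i \<in> {1..n}" "j \<in> {1..n}" "i < j" "- \<beta> i \<noteq> 0" "- \<beta> j \<noteq> 0" for t i j
      using ordered[OF that(1-4)] that(5,6) by simp
    show "((\<lambda>s. x s i) has_real_derivative (1 / real n) *
        (\<Sum>j\<in>{1..n} - {i}. of_int (- \<beta> i) * of_int (- \<beta> j) / (x t i - x t j))) (at t)"
      if "t \<in> {\<tau> - \<delta><..<\<tau>}" "i \<in> {1..n}" for t i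
      using ode[OF that] by simp
  qed (fact n_pos \<delta> cont)+
qed

section \<open>From solutions to the local description\<close>

text \<open>
  A right-continuous charge that does not jump on an interval is continuous there and takes finitely
  many values, so it is constant.
\<close>

lemma pre_collision_of_solution:
  assumes n: "n > 0" and \<tau>: "\<tau> > 0" and sol: "solves_P n (\<tau> + 1) x0 b0 x b"
  shows "\<exists>\<beta> \<delta>. pre_collision n x b \<beta> \<tau> \<delta>"
proof -
  \<comment> \<open>A horizon beyond \<open>\<tau>\<close> makes \<open>\<tau>\<close> an interior
    time, with right-continuity and two-sided continuity available there.\<close>
  let ?T = "\<tau> + 1"
  from sol[unfolded solves_P_def] show ?thesis
  proof (elim conjE exE, goal_cases)
    case (1 S)
    note config = 1(1)[rule_format] and fin = 1(2) and rc = 1(5)[rule_format]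
      and conserved = 1(9)[rule_format] and ode = 1(10)[rule_format]
    have cont: "continuous_on {0..?T} (\<lambda>t. x t i)" if "i \<in> {1..n}" for i
      using 1(4)[rule_format, OF that] by blast
    have jumps: "t \<in> S" if "i \<in> {1..n}" "t \<in> {0<..?T}" "jumps_at (\<lambda>r. b r i) t" for i t
      using 1(8)[rule_format, OF that] by blast
    have vals: "b t i \<in> {-1, 0, 1}" if "t \<in> {0..?T}" "i \<in> {1..n}" for t i
      using config[OF that(1)] that(2) by (auto simp: configs_def)
    have "\<forall>\<^sub>F t in at \<tau>. t \<notin> S"
      using islimpt_finite[OF fin, of \<tau>] by (simp add: islimpt_iff_eventually)
    then obtain \<delta>1 where \<delta>1: "\<delta>1 > 0" "\<And>t. t \<noteq> \<tau> \<Longrightarrow> \<bar>t - \<tau>\<bar> < \<delta>1 \<Longrightarrow> t \<notin> S"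
      unfolding eventually_at by (auto simp: dist_real_def)
    \<comment> \<open>Admissible charges at distance less than \<open>1\<close> are equal, so this
      is constancy just after \<open>\<tau>\<close>.\<close>
    have "\<forall>\<^sub>F t in at_right \<tau>. \<forall>i\<in>{1..n}. \<bar>b t i - b \<tau> i\<bar> < 1"
    proof (intro eventually_ball_finite ballI)
      fix i assume "i \<in> {1..n}"
      then show "\<forall>\<^sub>F t in at_right \<tau>. \<bar>b t i - b \<tau> i\<bar> < 1"
        using rc[of i \<tau>] \<tau> tendstoD[of "\<lambda>s. b s i" "b \<tau> i" "at_right \<tau>" 1] by (simp add: dist_real_def)
    qed simp
    then obtain t2 where t2: "t2 > \<tau>" "\<And>t i. \<tau> < t \<Longrightarrow> t < t2 \<Longrightarrow> i \<in> {1..n} \<Longrightarrow> \<bar>b t i - b \<tau> i\<bar> < 1"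
      unfolding eventually_at_right_field by blast
    \<comment> \<open>The four entries keep times positive, avoid \<open>S\<close> away from
      \<open>\<tau>\<close>, keep charges constant after \<open>\<tau>\<close> and stay within the
      horizon.\<close>
    define \<delta> where "\<delta> = Min {\<tau>, \<delta>1, t2 - \<tau>, 1}"
    have \<delta>: "0 < \<delta>" "\<delta> \<le> \<tau>" "\<delta> \<le> \<delta>1" "\<delta> \<le> t2 - \<tau>" "\<delta> \<le> 1"
      using \<tau> \<delta>1(1) t2(1) by (auto simp: \<delta>_def)
    define c where "c i = b (\<tau> - \<delta> / 2) i" for i
    have before: "b t i = c i" if t: "t \<in> {\<tau> - \<delta><..<\<tau>}" and i: "i \<in> {1..n}" for t i
    proof -
      let ?J = "{\<tau> - \<delta><..<\<tau>}"
      have "isCont (\<lambda>s. b s i) s" if s: "s \<in> ?J" for s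
      proof -
        have "s \<notin> S" "s \<in> {0<..?T}" "s \<in> {0..<?T}"
          using s \<delta> \<delta>1(2)[of s] by auto
        then have "((\<lambda>s. b s i) \<longlongrightarrow> b s i) (at_left s)" "((\<lambda>s. b s i) \<longlongrightarrow> b s i) (at_right s)"
          using jumps[OF i, of s] rc[OF i, of s] by (auto simp: jumps_at_def)
        then show ?thesis
          by (simp add: isCont_def filterlim_at_split)
      qed
      then have "continuous_on ?J (\<lambda>s. b s i)"
        by (intro continuous_at_imp_continuous_on) auto
      moreover have "(\<lambda>s. b s i) ` ?J \<subseteq> {-1, 0, 1}"
        using \<delta>(2,5) by (intro image_subsetI vals i) auto
      then have "finite ((\<lambda>s. b s i) ` ?J)"
        by (rule finite_subset) simp
      ultimately have "(\<lambda>s. b s i) constant_on ?J"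
        by (rule continuous_finite_range_constant[OF connected_Ioo])
      then obtain d where "\<And>s. s \<in> ?J \<Longrightarrow> b s i = d"
        unfolding constant_on_def by blast
      moreover have "\<tau> - \<delta> / 2 \<in> ?J"
        using \<delta>(1) by simp
      ultimately show ?thesis
        using t by (simp add: c_def)
    qed
    define \<beta> :: "nat \<Rightarrow> int" where "\<beta> i = (if c i = 1 then 1 else if c i = -1 then -1 else 0)" for i
    have c: "c i = of_int (\<beta> i)" "\<beta> i \<in> {-1, 0, 1}" if "i \<in> {1..n}" for i
      using vals[of "\<tau> - \<delta> / 2" i] that \<delta> unfolding \<beta>_def c_def by auto
    have left: "((\<lambda>s. b s i) \<longlongrightarrow> c i) (at_left \<tau>)" if "i \<in> {1..n}" for i
    proof (rule tendsto_eventually)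
      show "\<forall>\<^sub>F s in at_left \<tau>. b s i = c i"
        unfolding eventually_at_left_field using \<delta>(1)
        by (intro exI[of _ "\<tau> - \<delta>"] conjI allI impI before that) auto
    qed
    have "pre_collision n x b \<beta> \<tau> \<delta>"
    proof
      show "n > 0" "0 < \<delta>" "\<delta> \<le> \<tau>" by (fact n \<delta>)+
      show "\<beta> j \<in> {-1, 0, 1}" if "j \<in> {1..n}" for j
        by (fact c(2)[OF that])
      show "b t j = of_int (\<beta> j)" if "t \<in> {\<tau> - \<delta><..<\<tau>}" "j \<in> {1..n}" for t j
        using before[OF that] c(1)[OF that(2)] by simp
      show "b t j = b \<tau> j" if "t \<in> {\<tau>..<\<tau> + \<delta>}" "j \<in> {1..n}" for t j
      proof (cases "t = \<tau>")
        case False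
        then have "\<bar>b t j - b \<tau> j\<bar> < 1"
          using that t2(2)[of t j] \<delta> by auto
        then show ?thesis
          using vals[of t j] vals[of \<tau> j] that \<delta> \<tau> by auto
      qed simp
      show "x t i < x t j" if "t \<in> {\<tau> - \<delta><..<\<tau>}" "i \<in> {1..n}" "j \<in> {1..n}" "i < j" "\<beta> i \<noteq> 0" "\<beta> j \<noteq> 0"
        for t i j
      proof -
        have "b t j * b t i \<noteq> 0"
          using before[OF that(1)] c(1) that by simp
        then show ?thesis
          using config[of t] that \<delta> by (auto simp: configs_def)
      qed
      show "(x \<tau>, b \<tau>) \<in> configs n"
        using \<tau> by (intro config) auto
      show "isCont (\<lambda>t. x t j) \<tau>" if "j \<in> {1..n}" for j
        using cont[OF that] \<tau> by (intro continuous_on_interior[of "{0..?T}"]) auto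
      show "((\<lambda>s. x s i) has_real_derivative
          (1 / real n) * (\<Sum>j\<in>{1..n} - {i}. of_int (\<beta> i) * of_int (\<beta> j) / (x t i - x t j))) (at t)"
        if t: "t \<in> {\<tau> - \<delta><..<\<tau>}" and i: "i \<in> {1..n}" for t i
      proof -
        have "t \<in> {0<..<?T} - S"
          using t \<delta> \<delta>1(2)[of t] by auto
        moreover have "(\<Sum>j\<in>{1..n} - {i}. b t i * b t j / (x t i - x t j)) =
            (\<Sum>j\<in>{1..n} - {i}. of_int (\<beta> i) * of_int (\<beta> j) / (x t i - x t j))"
          using before[OF t] c(1) i by (intro sum.cong) auto
        ultimately show ?thesis
          using ode[OF i, of t] by simp
      qed
      show "(\<Sum>j | j \<in> {1..n} \<and> x \<tau> j = y. b \<tau> j) = (\<Sum>j | j \<in> {1..n} \<and> x \<tau> j = y. of_int (\<beta> j))" for y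
      proof (cases "\<tau> \<in> S")
        case True
        have "left_limit (\<lambda>r. b r j) \<tau> = of_int (\<beta> j)" if "j \<in> {1..n}" for j
          unfolding left_limit_def using tendsto_Lim[OF trivial_limit_at_left_real left[OF that]] c(1)[OF that] by simp
        then have "(\<Sum>j | j \<in> {1..n} \<and> x \<tau> j = y. b \<tau> j - of_int (\<beta> j)) =
            (\<Sum>j | j \<in> {1..n} \<and> x \<tau> j = y. b \<tau> j - left_limit (\<lambda>r. b r j) \<tau>)"
          by (intro sum.cong) auto
        also have "\<dots> = 0"
          by (rule conserved[OF True])
        finally show ?thesis
          by (simp only: sum_subtractf)
      next
        \<comment> \<open>Outside \<open>S\<close> no charge jumps, so conservation holds particle
          by particle.\<close>
        case False
        have "b \<tau> j = of_int (\<beta> j)" if "j \<in> {1..n}" for j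
        proof -
          have "((\<lambda>s. b s j) \<longlongrightarrow> b \<tau> j) (at_left \<tau>)"
            using jumps[OF that, of \<tau>] False \<tau> by (auto simp: jumps_at_def)
          then show ?thesis
            using tendsto_unique[OF trivial_limit_at_left_real] left[OF that] c(1)[OF that] by metis
        qed
        then show ?thesis
          by (intro sum.cong) auto
      qed
    qed
    then show ?thesis by blast
  qed
qed

theorem lemma4p2:
  fixes n :: nat
    and x0 b0 :: "nat \<Rightarrow> real"
    and x b :: "real \<Rightarrow> nat \<Rightarrow> real"
    and \<rho> :: real
  assumes "n \<ge> 2"
    and "(x0, b0) \<in> configs n"
    and "\<And>T. T > 0 \<Longrightarrow> solves_P n T x0 b0 x b"
    and "\<rho> > 0"
  shows "viscosity_solution \<rho> (1 / real n) (u_n n x b)"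
proof -
  have approach: "\<exists>\<beta> \<delta>. pre_collision n x b \<beta> \<tau> \<delta>" if "\<tau> > 0" for \<tau>
    using assms(1) that assms(3)[of "\<tau> + 1"] by (intro pre_collision_of_solution) auto
  then have "\<exists>\<beta> \<delta>. pre_collision n x (\<lambda>t j. - b t j) \<beta> \<tau> \<delta>" if "\<tau> > 0" for \<tau>
    using pre_collision_minus that by blast
  then have "subsolution \<rho> (1 / real n) (usc_env Q (u_n n x (\<lambda>t j. - b t j)))"
    using assms(4) by (rule subsolution_of_pre_collision)
  moreover have "u_n n x (\<lambda>t j. - b t j) = (\<lambda>q. - u_n n x b q)"
    by (auto simp: u_n_def sum_negf)
  ultimately have "supersolution \<rho> (1 / real n) (lsc_env Q (u_n n x b))"
    using assms(1) by (intro supersolution_minus) (simp_all add: lsc_env_eq[abs_def])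
  with subsolution_of_pre_collision[OF approach assms(4)] show ?thesis
    by (simp add: viscosity_solution_def)
qed

end
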